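(* Let $n$ be a positive integer and define the cubic polynomial $$P_{n}(T)=T^{3}+\frac{n-1}{n}T^{2}+(2n-1)T+\frac{-2n+1}{n}.$$ There exists a unique real root $\theta_{n}$ of $P_{n}$ in the interval $(0,1/n)$, and for every real transcendental number $\zeta$ we have $$\widehat{\lambda}_{2n}(\zeta)\leq \theta_{n}.$$
   Context: For an integer $k\geq 1$ and a real transcendental number $\zeta$, $\widehat{\lambda}_{k}(\zeta)$ is the supremum of $\eta\in\mathbb{R}$ such that for all sufficiently large $X$ the system $|x|\leq X$, $\max_{1\leq i\leq k}|\zeta^{i}x-y_{i}|\leq X^{-\eta}$ has a non-zero solution $(x,y_{1},\ldots,y_{k})\in\mathbb{Z}^{k+1}$. *)

theory Defs
  imports Complex_Main "HOL-Library.Extended_Real" "HOL-Computational_Algebra.Polynomial"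
begin

text \<open>The parameter \<open>X\<close> ranges over the reals, and a solution is non-zero if the tuple
  \<open>(x, y\<^sub>1, \<dots>, y\<^sub>k)\<close> is, i.e. \<open>x = 0\<close> by itself is not excluded. The values \<open>y i\<close> for
  \<open>i\<close> outside \<open>{1..k}\<close> are irrelevant.\<close>

definition uniform_exponent :: "nat \<Rightarrow> real \<Rightarrow> real \<Rightarrow> bool" where
  "uniform_exponent k \<zeta> \<eta> \<longleftrightarrow>
     (\<forall>\<^sub>F X :: real in at_top. \<exists>(x :: int) (y :: nat \<Rightarrow> int).
        (x \<noteq> 0 \<or> (\<exists>i\<in>{1..k}. y i \<noteq> 0)) \<and>
        \<bar>real_of_int x\<bar> \<le> X \<and>
        (MAX i\<in>{1..k}. \<bar>\<zeta> ^ i * of_int x - of_int (y i)\<bar>) \<le> X powr (- \<eta>))"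

text \<open>The supremum is taken in the extended reals, so that no boundedness is presupposed.
  The definition is meant for \<open>k \<ge> 1\<close> (for \<open>k = 0\<close> the maximum above is over the empty set).\<close>

definition lambda_hat :: "nat \<Rightarrow> real \<Rightarrow> ereal" where
  "lambda_hat k \<zeta> = (SUP \<eta>\<in>{\<eta>. uniform_exponent k \<zeta> \<eta>}. ereal \<eta>)"

text \<open>Coefficients are listed from the constant term upwards.\<close>

definition P :: "nat \<Rightarrow> real poly" where
  "P n = [: (- 2 * real n + 1) / real n, 2 * real n - 1, (real n - 1) / real n, 1 :]"

end

theory Submission
  imports Defs
    "Berlekamp_Zassenhaus.Factor_Bound"
    "Subresultants.Subresultant_Gcd"
    "HOL-Real_Asymp.Real_Asymp"
begin

text \<open>
  That the cubic has exactly one root \<open>\<theta>\<close> in \<open>(0, 1 / n)\<close> follows from its signs at the end points and its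
  monotonicity. For the bound, suppose that the system is solvable for all large \<open>X\<close> with
  an exponent \<open>\<eta> > \<theta>\<close>; lowering \<open>\<eta>\<close>, one may assume \<open>\<eta> < 1 / n\<close>. Three estimates
  contradict each other.

  First, uniform approximability improves itself infinitely often
  (\<open>uniform_imp_ordinary_exponent\<close>): for every \<open>\<alpha>\<close> below
  \<open>\<eta> (\<eta> + 2 n - 2) / ((2 n - 1) (1 - \<eta>))\<close> there are infinitely many \<open>q\<close> such that all of
  \<open>\<zeta> q, \<dots>, \<zeta>\<^sup>2\<^sup>n q\<close> are within \<open>q powr (- \<alpha>)\<close> of integers. The proof
  bounds the determinant of \<open>2 n + 1\<close> linearly independent best approximations. It is a non-zero
  integer, but if the claim failed, it would be small, because the chosen approximations
  can be corrected by multiples of the ones that precede them in the sequence: they are chosen such that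
  the latter lie in the span of those used already.

  Second, Khintchine's transference principle, applied to \<open>\<zeta>, \<dots>, \<zeta>\<^sup>n\<close> alone, turns such
  \<open>q\<close> into integer polynomials \<open>f\<close> of degree at most \<open>n\<close> with \<open>\<bar>f(\<zeta>)\<bar>\<close> smaller than the power
  \<open>- w\<close> of the height of \<open>f\<close>, for every \<open>w < n - 1 + n \<alpha>\<close> (\<open>khintchine_transference\<close>).

  Third, such polynomials cannot exist for \<open>w > 1 / \<eta>\<close> if \<open>\<eta> > 1 / (n + 1)\<close>, which holds
  because already \<open>\<theta> > 1 / (n + 1)\<close> (\<open>contradiction_from_small_polynomials\<close>).
  A prime factor of \<open>f\<close> is as good as \<open>f\<close>, because the Mahler measure, which serves as the height, is multiplicative. Dirichlet's principle gives a
  polynomial \<open>g\<close> of degree at most \<open>n + 1\<close> whose height is smaller by a constant factor, hence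
  not divisible by the prime polynomial \<open>f\<close>. For a solution \<open>v\<close> of the system at a suitable \<open>X\<close>, the sums
  \<open>\<Sum>i. f\<^sub>i v\<^sub>i\<^sub>+\<^sub>k\<close> and \<open>\<Sum>i. g\<^sub>i v\<^sub>i\<^sub>+\<^sub>k\<close> are integers of absolute value
  below \<open>1\<close>, so they vanish. As \<open>f\<close> and \<open>g\<close> are coprime, Bezout's identity makes \<open>v\<close> orthogonal to all
  polynomials of degree at most \<open>2 n\<close>, so that \<open>v = 0\<close>.

  Consequently \<open>1 / \<eta> \<ge> n - 1 + n \<alpha>\<close> for every admissible \<open>\<alpha>\<close>. Clearing denominators in the limiting
  inequality gives \<open>P n (\<eta>) \<le> 0\<close>, that is \<open>\<eta> \<le> \<theta>\<close>.
\<close>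

(* These names of abstract univariate polynomials would shadow coeff and monom. *)
hide_const (open) up_ring.coeff up_ring.monom

section \<open>Spans and determinants of integer vectors\<close>

text \<open>Integer vectors of length \<open>N + 1\<close> are functions on \<open>nat\<close> of which only the values at
  \<open>0, \<dots>, N\<close> count, so that \<open>N\<close> can be arbitrary. A point \<open>(x, y\<^sub>1, \<dots>, y\<^sub>N)\<close> has its denominator \<open>x\<close> at index \<open>0\<close>.
  Real coefficients are harmless, since an integer functional that vanishes on the
  generators also vanishes on their real span.\<close>

definition in_span :: "nat \<Rightarrow> nat \<Rightarrow> (nat \<Rightarrow> nat \<Rightarrow> int) \<Rightarrow> (nat \<Rightarrow> int) \<Rightarrow> bool" where
  "in_span N m w y \<longleftrightarrow>
     (\<exists>c :: nat \<Rightarrow> real. \<forall>i\<le>N. real_of_int (y i) = (\<Sum>l<m. c l * real_of_int (w l i)))"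

lemma in_span_cong:
  assumes "\<And>l. l < m \<Longrightarrow> w l = w' l"
  shows "in_span N m w y \<longleftrightarrow> in_span N m w' y"
  unfolding in_span_def using assms by (metis (no_types, lifting) lessThan_iff sum.cong)

lemma in_span_member:
  assumes "l < m"
  shows "in_span N m w (w l)"
  unfolding in_span_def
proof (intro exI[of _ "\<lambda>k. if k = l then 1 else 0"] allI impI)
  fix i
  show "real_of_int (w l i) = (\<Sum>k<m. (if k = l then 1 else 0) * real_of_int (w k i))"
    using assms by (simp add: if_distrib[of "\<lambda>x. x * _"] sum.delta cong: if_cong)
qed

text \<open>At most \<open>N\<close> vectors leave room for one more row: padding them with zero rows to a square matrix
  gives determinant \<open>0\<close>, and a singular integer matrix has an integer vector in its kernel. Integrality
  matters, because the functional will be turned into a polynomial that would vanish at \<open>\<zeta>\<close>.\<close>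

lemma exists_annihilating_functional:
  fixes w :: "nat \<Rightarrow> nat \<Rightarrow> int"
  assumes "m \<le> N"
  obtains a :: "nat \<Rightarrow> int" where "\<exists>i\<le>N. a i \<noteq> 0" "\<And>l. l < m \<Longrightarrow> (\<Sum>i\<le>N. a i * w l i) = 0"
proof -
  define R where "R = (\<lambda>l. vec (Suc N) (\<lambda>i. if l < m then w l i else 0))"
  define A where "A = mat\<^sub>r (Suc N) (Suc N) (\<lambda>l. if l = N then 0\<^sub>v (Suc N) else R l)"
  have A: "A \<in> carrier_mat (Suc N) (Suc N)"
    unfolding A_def by simp
  have "det A = 0"
    unfolding A_def by (rule det_row_0) (auto simp: R_def)
  then obtain v where v: "v \<in> carrier_vec (Suc N)" "v \<noteq> 0\<^sub>v (Suc N)" "A *\<^sub>v v = 0\<^sub>v (Suc N)"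
    using det_0_iff_vec_prod_zero[OF A] by blast
  show ?thesis
  proof (rule that[of "\<lambda>i. v $ i"])
    show "\<exists>i\<le>N. v $ i \<noteq> 0"
    proof (rule ccontr)
      assume "\<not> ?thesis"
      hence "v = 0\<^sub>v (Suc N)"
        using v(1) by (intro eq_vecI) auto
      with v(2) show False by simp
    qed
  next
    fix l assume l: "l < m"
    hence lN: "l < N" using assms by simp
    have "row A l = R l"
      unfolding A_def using lN by (subst row_mat_of_row_fun) (auto simp: R_def)
    have "(\<Sum>i\<le>N. v $ i * w l i) = (\<Sum>i = 0..<Suc N. R l $ i * v $ i)"
      using l by (intro sum.cong) (auto simp: R_def)
    also have "\<dots> = (A *\<^sub>v v) $ l"
      using lN v(1) A \<open>row A l = R l\<close> by (simp add: scalar_prod_def)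
    also have "\<dots> = 0"
      using lN by (simp add: v(3))
    finally show "(\<Sum>i\<le>N. v $ i * w l i) = 0" .
  qed
qed

text \<open>A sequence that no hyperplane with integer coefficients contains from some index on cannot stay
  in the span of at most \<open>N\<close> vectors; \<open>Suc j\<close> is the first index after \<open>s\<close> at which it is outside.\<close>

lemma leaves_span:
  fixes w x :: "nat \<Rightarrow> nat \<Rightarrow> int"
  assumes gen: "\<And>a s. \<exists>i\<le>N. a i \<noteq> 0 \<Longrightarrow> \<exists>t\<ge>s. (\<Sum>i\<le>N. a i * x t i) \<noteq> 0"
      and "m \<le> N" "in_span N m w (x s)"
  obtains j where "j \<ge> s" "in_span N m w (x j)" "\<not> in_span N m w (x (Suc j))"
proof -
  obtain a where a: "\<exists>i\<le>N. a i \<noteq> 0" "\<And>l. l < m \<Longrightarrow> (\<Sum>i\<le>N. a i * w l i) = 0"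
    using exists_annihilating_functional[OF assms(2)] by metis
  obtain t0 where t0: "t0 \<ge> s" "(\<Sum>i\<le>N. a i * x t0 i) \<noteq> 0"
    using gen[OF a(1)] by blast
  have "\<not> in_span N m w (x t0)"
  proof
    assume "in_span N m w (x t0)"
    then obtain c where c: "\<And>i. i \<le> N \<Longrightarrow> real_of_int (x t0 i) = (\<Sum>l<m. c l * real_of_int (w l i))"
      unfolding in_span_def by blast
    have "real_of_int (\<Sum>i\<le>N. a i * x t0 i) = (\<Sum>i\<le>N. \<Sum>l<m. real_of_int (a i) * (c l * real_of_int (w l i)))"
      by (simp add: c sum_distrib_left)
    also have "\<dots> = (\<Sum>l<m. \<Sum>i\<le>N. real_of_int (a i) * (c l * real_of_int (w l i)))"
      by (rule sum.swap)
    also have "\<dots> = (\<Sum>l<m. c l * real_of_int (\<Sum>i\<le>N. a i * w l i))"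
      by (simp add: sum_distrib_left mult_ac)
    also have "\<dots> = 0"
      using a(2) by simp
    finally show False
      using t0(2) by linarith
  qed
  define t where "t = (LEAST t. t \<ge> s \<and> \<not> in_span N m w (x t))"
  have t: "t \<ge> s" "\<not> in_span N m w (x t)"
    unfolding t_def using LeastI[of "\<lambda>t. t \<ge> s \<and> \<not> in_span N m w (x t)" t0] t0(1) \<open>\<not> in_span N m w (x t0)\<close>
    by blast+
  hence "t > s"
    using assms(3) by (metis le_neq_implies_less)
  show ?thesis
  proof (rule that[of "t - 1"])
    show "t - 1 \<ge> s" using \<open>t > s\<close> by simp
    show "\<not> in_span N m w (x (Suc (t - 1)))" using \<open>t > s\<close> t(2) by simp
    show "in_span N m w (x (t - 1))"
    proof (rule ccontr)
      assume "\<not> ?thesis"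
      with \<open>t - 1 \<ge> s\<close> have "t \<le> t - 1"
        unfolding t_def by (intro Least_le) auto
      with \<open>t > s\<close> show False by simp
    qed
  qed
qed

text \<open>Iterated escape: each time the sequence leaves the span of the vectors collected so far, the
  first vector outside is added. What matters later is that the last vector before the exit,
  \<open>x (j k)\<close>, still lies in the old span: a multiple of it can be subtracted from the new vector
  without changing the determinant.\<close>

lemma escaping_chain:
  fixes x :: "nat \<Rightarrow> nat \<Rightarrow> int"
  assumes gen: "\<And>a s. \<exists>i\<le>N. a i \<noteq> 0 \<Longrightarrow> \<exists>t\<ge>s. (\<Sum>i\<le>N. a i * x t i) \<noteq> 0"
  shows "\<exists>j w. w 0 = x s \<and> (\<forall>k<N. w (Suc k) = x (Suc (j k)) \<and> s \<le> j k \<and> (0 < k \<longrightarrow> j 0 < j k) \<and>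
           in_span N (Suc k) w (x (j k)) \<and> \<not> in_span N (Suc k) w (w (Suc k)))"
proof -
  let ?Q = "\<lambda>m j w. w 0 = x s \<and> (\<forall>k<m. w (Suc k) = x (Suc (j k)) \<and> s \<le> j k \<and> (0 < k \<longrightarrow> j 0 < j k) \<and>
               in_span N (Suc k) w (x (j k)) \<and> \<not> in_span N (Suc k) w (w (Suc k)))"
  have "\<exists>j w. ?Q m j w" if "m \<le> N" for m
    using that
  proof (induction m)
    case 0
    show ?case by (intro exI[of _ id] exI[of _ "\<lambda>_. x s"]) simp
  next
    case (Suc m)
    then obtain j w where jw: "?Q m j w" by auto
    \<comment> \<open>the index at which the current last vector occurs, so that the next search starts inside the span\<close>
    define s' where "s' = (if m = 0 then s else Suc (j (m - 1)))"
    have "x s' = w m"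
      unfolding s'_def using jw by (cases m) auto
    hence "in_span N (Suc m) w (x s')"
      using in_span_member[of m "Suc m" N w] by simp
    then obtain t where t: "t \<ge> s'" "in_span N (Suc m) w (x t)" "\<not> in_span N (Suc m) w (x (Suc t))"
      using leaves_span[of N x "Suc m" w s'] gen Suc.prems by blast
    define j' where "j' = j(m := t)"
    define w' where "w' = w(Suc m := x (Suc t))"
    have cong: "in_span N (Suc k) w' y \<longleftrightarrow> in_span N (Suc k) w y" if "k \<le> m" for k y
      using that by (intro in_span_cong) (auto simp: w'_def)
    have "s \<le> t"
      using t(1) jw unfolding s'_def by (cases m) (auto dest!: spec[of _ "m - 1"])
    moreover have "j 0 < t" if "0 < m"
    proof -
      have "j 0 \<le> j (m - 1)"
        using jw that by (cases "m - 1 = 0") (auto dest!: spec[of _ "m - 1"])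
      thus ?thesis using t(1) that unfolding s'_def by simp
    qed
    ultimately have "?Q (Suc m) j' w'"
      using jw t by (auto simp: less_Suc_eq cong) (auto simp: j'_def w'_def)
    thus ?case by blast
  qed
  thus ?thesis by blast
qed

text \<open>In a linear relation between the rows, the last row with a non-zero coefficient would lie in the
  span of the rows before it.\<close>

lemma det_nonzero_if_escaping:
  fixes w :: "nat \<Rightarrow> nat \<Rightarrow> int"
  assumes "\<And>k. k \<le> N \<Longrightarrow> \<not> in_span N k w (w k)"
  shows "det (mat (Suc N) (Suc N) (\<lambda>(k, i). w k i)) \<noteq> 0"
proof
  define A where "A = mat (Suc N) (Suc N) (\<lambda>(k, i). w k i)"
  have A: "A \<in> carrier_mat (Suc N) (Suc N)" "transpose_mat A \<in> carrier_mat (Suc N) (Suc N)"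
    by (simp_all add: A_def)
  assume "det (mat (Suc N) (Suc N) (\<lambda>(k, i). w k i)) = 0"
  hence "det (transpose_mat A) = 0"
    using det_transpose[OF A(1)] by (simp add: A_def)
  then obtain v where v: "v \<in> carrier_vec (Suc N)" "v \<noteq> 0\<^sub>v (Suc N)" "transpose_mat A *\<^sub>v v = 0\<^sub>v (Suc N)"
    using det_0_iff_vec_prod_zero[OF A(2)] by blast
  have rel: "(\<Sum>l<Suc N. v $ l * w l i) = 0" if "i \<le> N" for i
  proof -
    have "(\<Sum>l<Suc N. v $ l * w l i) = (\<Sum>l = 0..<Suc N. w l i * v $ l)"
      by (intro sum.cong) auto
    also have "\<dots> = (transpose_mat A *\<^sub>v v) $ i"
      using that v(1) by (simp add: A_def scalar_prod_def)
    finally show ?thesis using that by (simp add: v(3))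
  qed
  define S where "S = {l. l \<le> N \<and> v $ l \<noteq> 0}"
  have "S \<noteq> {}"
  proof
    assume "S = {}"
    hence "v = 0\<^sub>v (Suc N)"
      using v(1) by (intro eq_vecI) (auto simp: S_def)
    with v(2) show False by simp
  qed
  moreover have "finite S" by (simp add: S_def)
  ultimately have k: "Max S \<in> S" "\<And>l. l \<in> S \<Longrightarrow> l \<le> Max S" by simp_all
  define k where "k = Max S"
  have kN: "k \<le> N" "v $ k \<noteq> 0" using k(1) by (auto simp: S_def k_def)
  have zero: "v $ l = 0" if "k < l" "l \<le> N" for l
    using k(2)[of l] that unfolding k_def[symmetric] by (auto simp: S_def)
  have "in_span N k w (w k)"
    unfolding in_span_def
  proof (intro exI[of _ "\<lambda>l. - real_of_int (v $ l) / real_of_int (v $ k)"] allI impI)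
    fix i assume i: "i \<le> N"
    have "(\<Sum>l<Suc N. v $ l * w l i) = (\<Sum>l<Suc k. v $ l * w l i)"
      using kN zero by (intro sum.mono_neutral_right) auto
    hence "real_of_int ((\<Sum>l<k. v $ l * w l i) + v $ k * w k i) = 0"
      using rel[OF i] by simp
    hence "real_of_int (w k i) = - (\<Sum>l<k. real_of_int (v $ l) * real_of_int (w l i)) / real_of_int (v $ k)"
      using kN(2) by (simp add: field_simps)
    also have "\<dots> = (\<Sum>l<k. - real_of_int (v $ l) / real_of_int (v $ k) * real_of_int (w l i))"
      by (simp add: sum_divide_distrib sum_negf)
    finally show "real_of_int (w k i) = (\<Sum>l<k. - real_of_int (v $ l) / real_of_int (v $ k) * real_of_int (w l i))" .
  qed
  with assms kN(1) show False by blast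
qed

lemma abs_det_le:
  fixes A :: "real mat"
  assumes A: "A \<in> carrier_mat n n"
      and bound: "\<And>k i. k < n \<Longrightarrow> i < n \<Longrightarrow> \<bar>A $$ (k, i)\<bar> \<le> b k"
  shows "\<bar>det A\<bar> \<le> fact n * (\<Prod>k<n. b k)"
proof -
  have "\<bar>det A\<bar> \<le> (\<Sum>p | p permutes {0..<n}. \<bar>signof p * (\<Prod>i = 0..<n. A $$ (i, p i))\<bar>)"
    unfolding det_def'[OF A] by (rule sum_abs)
  also have "\<dots> \<le> (\<Sum>p | p permutes {0..<n}. \<Prod>k<n. b k)"
  proof (intro sum_mono)
    fix p assume "p \<in> {p. p permutes {0..<n}}"
    hence p: "p permutes {0..<n}" by simp
    have "\<bar>signof p * (\<Prod>i = 0..<n. A $$ (i, p i))\<bar> = (\<Prod>i = 0..<n. \<bar>A $$ (i, p i)\<bar>)"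
      by (simp add: abs_mult abs_prod sign_def)
    also have "\<dots> \<le> (\<Prod>k = 0..<n. b k)"
      using permutes_in_image[OF p] by (intro prod_mono) (auto intro!: bound)
    also have "\<dots> = (\<Prod>k<n. b k)"
      by (simp add: atLeast0LessThan)
    finally show "\<bar>signof p * (\<Prod>i = 0..<n. A $$ (i, p i))\<bar> \<le> (\<Prod>k<n. b k)" .
  qed
  also have "\<dots> = fact n * (\<Prod>k<n. b k)"
    by (simp add: card_permutations)
  finally show ?thesis .
qed

lemma det_unitriangular_rows:
  fixes w z :: "nat \<Rightarrow> nat \<Rightarrow> real"
  assumes "\<And>k i. k < n \<Longrightarrow> i < n \<Longrightarrow> z k i = w k i - (\<Sum>l<k. d k l * w l i)"
  shows "det (mat n n (\<lambda>(k, i). z k i)) = det (mat n n (\<lambda>(k, i). w k i))"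
proof -
  define U where "U = mat n n (\<lambda>(k, l). if l < k then - d k l else if l = k then 1 else 0)"
  define W where "W = mat n n (\<lambda>(k, i). w k i)"
  have U: "U \<in> carrier_mat n n" and W: "W \<in> carrier_mat n n"
    by (simp_all add: U_def W_def)
  have "det U = prod_list (diag_mat U)"
    by (rule det_lower_triangular[OF _ U]) (auto simp: U_def)
  also have "diag_mat U = replicate n 1"
    by (intro nth_equalityI) (auto simp: diag_mat_def U_def)
  finally have "det U = 1" by simp
  have "mat n n (\<lambda>(k, i). z k i) = U * W"
  proof (rule eq_matI)
    fix k i assume "k < dim_row (U * W)" "i < dim_col (U * W)"
    hence ki: "k < n" "i < n" by (simp_all add: U_def W_def)
    have "(U * W) $$ (k, i) = (\<Sum>l<n. (if l < k then - d k l else if l = k then 1 else 0) * w l i)"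
      using ki by (simp add: U_def W_def scalar_prod_def atLeast0LessThan)
    also have "\<dots> = (\<Sum>l<Suc k. (if l < k then - d k l else if l = k then 1 else 0) * w l i)"
      using ki by (intro sum.mono_neutral_right) auto
    also have "\<dots> = z k i"
      using ki by (simp add: assms sum_negf)
    finally show "mat n n (\<lambda>(k, i). z k i) $$ (k, i) = (U * W) $$ (k, i)"
      using ki by simp
  qed (auto simp: U_def W_def)
  thus ?thesis
    using det_mult[OF U W] \<open>det U = 1\<close> by (simp add: W_def)
qed

section \<open>Best simultaneous approximations\<close>

definition approx_point :: "real \<Rightarrow> nat \<Rightarrow> nat \<Rightarrow> int" where
  "approx_point \<zeta> q i = round (\<zeta> ^ i * real q)"

definition approx_error :: "nat \<Rightarrow> real \<Rightarrow> nat \<Rightarrow> real" where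
  "approx_error N \<zeta> q = (MAX i\<in>{1..N}. \<bar>\<zeta> ^ i * real q - of_int (approx_point \<zeta> q i)\<bar>)"

text \<open>The denominators of best simultaneous approximation to \<open>\<zeta>, \<dots>, \<zeta>\<^sup>N\<close>, indexed by the size
  bound \<open>t\<close> instead of consecutively, so that a denominator is repeated until a better one appears.
  Taking the least minimiser makes the sequence change only when a strictly better denominator
  becomes available.\<close>

definition best_approx :: "nat \<Rightarrow> real \<Rightarrow> nat \<Rightarrow> nat" where
  "best_approx N \<zeta> t = (LEAST q. 1 \<le> q \<and> q \<le> t \<and>
     (\<forall>r. 1 \<le> r \<and> r \<le> t \<longrightarrow> approx_error N \<zeta> q \<le> approx_error N \<zeta> r))"

lemma approx_point_0 [simp]: "approx_point \<zeta> q 0 = int q"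
  by (simp add: approx_point_def)

lemma approx_error_nonneg: "N \<ge> 1 \<Longrightarrow> 0 \<le> approx_error N \<zeta> q"
  unfolding approx_error_def by (subst Max_ge_iff) auto

lemma approx_error_ge:
  assumes "i \<le> N" "N \<ge> 1"
  shows "\<bar>\<zeta> ^ i * real q - of_int (approx_point \<zeta> q i)\<bar> \<le> approx_error N \<zeta> q"
proof (cases "i = 0")
  case True
  thus ?thesis using approx_error_nonneg[OF assms(2)] by simp
next
  case False
  thus ?thesis
    unfolding approx_error_def using assms(1) by (intro Max_ge) auto
qed

lemma best_approx:
  assumes "t \<ge> 1"
  shows best_approx_pos: "1 \<le> best_approx N \<zeta> t"
    and best_approx_le: "best_approx N \<zeta> t \<le> t"
    and best_approx_minimal: "1 \<le> r \<Longrightarrow> r \<le> t \<Longrightarrow> approx_error N \<zeta> (best_approx N \<zeta> t) \<le> approx_error N \<zeta> r"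
proof -
  let ?Q = "\<lambda>q. 1 \<le> q \<and> q \<le> t \<and> (\<forall>r. 1 \<le> r \<and> r \<le> t \<longrightarrow> approx_error N \<zeta> q \<le> approx_error N \<zeta> r)"
  obtain q where "?Q q"
    using ex_is_arg_min_if_finite[of "{1..t}" "approx_error N \<zeta>"] assms
    by (auto simp: is_arg_min_linorder)
  hence "?Q (best_approx N \<zeta> t)"
    unfolding best_approx_def by (rule LeastI)
  thus "1 \<le> best_approx N \<zeta> t" "best_approx N \<zeta> t \<le> t"
    "1 \<le> r \<Longrightarrow> r \<le> t \<Longrightarrow> approx_error N \<zeta> (best_approx N \<zeta> t) \<le> approx_error N \<zeta> r"
    by blast+
qed

text \<open>The least minimiser for the bound \<open>t\<close> is also the least minimiser for every smaller bound that
  still admits it. So a new value of the sequence at \<open>t\<close> must be \<open>t\<close> itself.\<close>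

lemma best_approx_stable:
  assumes "s \<ge> 1" "s \<le> t" "best_approx N \<zeta> t \<le> s"
  shows "best_approx N \<zeta> s = best_approx N \<zeta> t"
proof (rule antisym)
  have t: "t \<ge> 1" using assms by simp
  show "best_approx N \<zeta> s \<le> best_approx N \<zeta> t"
    unfolding best_approx_def[of _ _ s]
    using best_approx[OF t, where N = N and \<zeta> = \<zeta>] assms by (intro Least_le) auto
  have "approx_error N \<zeta> (best_approx N \<zeta> s) \<le> approx_error N \<zeta> r" if "1 \<le> r" "r \<le> t" for r
    using best_approx_minimal[OF assms(1), of "best_approx N \<zeta> t" N \<zeta>] best_approx_pos[OF t, of N \<zeta>]
      best_approx_minimal[OF t that, of N \<zeta>] assms(3) by linarith
  thus "best_approx N \<zeta> t \<le> best_approx N \<zeta> s"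
    unfolding best_approx_def[of _ _ t]
    using best_approx[OF assms(1), where N = N and \<zeta> = \<zeta>] assms(2) by (intro Least_le) auto
qed

lemma best_approx_mono:
  assumes "s \<ge> 1" "s \<le> t"
  shows "best_approx N \<zeta> s \<le> best_approx N \<zeta> t"
proof (cases "best_approx N \<zeta> t \<le> s")
  case True
  thus ?thesis using best_approx_stable[OF assms] by simp
next
  case False
  thus ?thesis using best_approx_le[OF assms(1), of N \<zeta>] by linarith
qed

lemma transcendental_int_combination:
  fixes a :: "nat \<Rightarrow> int"
  assumes "\<not> algebraic (\<zeta> :: real)" "\<exists>i\<le>N. a i \<noteq> 0"
  shows "(\<Sum>i\<le>N. real_of_int (a i) * \<zeta> ^ i) \<noteq> 0"
proof
  assume sum0: "(\<Sum>i\<le>N. real_of_int (a i) * \<zeta> ^ i) = 0"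
  define f where "f = (\<Sum>i\<le>N. monom (real_of_int (a i)) i)"
  have coeff: "coeff f i = (if i \<le> N then real_of_int (a i) else 0)" for i
    by (simp add: f_def coeff_sum)
  have "poly f \<zeta> = 0"
    using sum0 by (simp add: f_def poly_sum poly_monom)
  moreover have "f \<noteq> 0"
    using assms(2) coeff by (metis coeff_0 of_int_eq_0_iff)
  ultimately have "algebraic \<zeta>"
    by (intro algebraicI[of f]) (auto simp: coeff)
  with assms(1) show False by simp
qed

text \<open>The point \<open>(q, y\<^sub>1, \<dots>, y\<^sub>N)\<close> divided by \<open>q\<close> tends to \<open>(1, \<zeta>, \<dots>, \<zeta>\<^sup>N)\<close>, and a rational hyperplane
  through the limit would be an algebraic equation for \<open>\<zeta>\<close>.\<close>

lemma best_approx_escapes_hyperplanes: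
  assumes "\<not> algebraic \<zeta>" "N \<ge> 1" "\<eta> > 0"
      and unif: "\<And>t. t \<ge> T \<Longrightarrow> approx_error N \<zeta> (best_approx N \<zeta> t) \<le> real t powr - \<eta>"
      and a: "\<exists>i\<le>N. a i \<noteq> 0"
  shows "\<exists>t\<ge>s. (\<Sum>i\<le>N. a i * approx_point \<zeta> (best_approx N \<zeta> t) i) \<noteq> 0"
proof -
  define A where "A = (\<Sum>i\<le>N. \<bar>real_of_int (a i)\<bar>)"
  define F where "F = (\<Sum>i\<le>N. real_of_int (a i) * \<zeta> ^ i)"
  have F: "F \<noteq> 0"
    unfolding F_def by (rule transcendental_int_combination[OF assms(1) a])
  have "(\<lambda>t :: nat. A * real t powr - \<eta>) \<longlonglongrightarrow> A * 0"
    using assms(3) by (intro tendsto_mult tendsto_const tendsto_neg_powr filterlim_real_sequentially) auto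
  hence "\<forall>\<^sub>F t in sequentially. A * real t powr - \<eta> < \<bar>F\<bar>"
    using F by (intro order_tendstoD(2)) auto
  hence "\<forall>\<^sub>F t in sequentially. A * real t powr - \<eta> < \<bar>F\<bar> \<and> t \<ge> max s (max T 1)"
    by (intro eventually_conj eventually_ge_at_top)
  from eventually_happens'[OF sequentially_bot this]
  obtain t where t: "A * real t powr - \<eta> < \<bar>F\<bar>" "t \<ge> s" "t \<ge> T" "t \<ge> 1"
    by auto
  define q where "q = best_approx N \<zeta> t"
  have q: "q \<ge> 1" "approx_error N \<zeta> q \<le> real t powr - \<eta>"
    using best_approx_pos[OF t(4)] unif[OF t(3)] by (auto simp: q_def)
  have "real q * F - (\<Sum>i\<le>N. real_of_int (a i) * real_of_int (approx_point \<zeta> q i)) =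
        (\<Sum>i\<le>N. real_of_int (a i) * (\<zeta> ^ i * real q - real_of_int (approx_point \<zeta> q i)))"
    by (simp add: F_def sum_distrib_left sum_subtractf algebra_simps)
  also have "\<bar>\<dots>\<bar> \<le> (\<Sum>i\<le>N. \<bar>real_of_int (a i)\<bar> * approx_error N \<zeta> q)"
    by (intro order_trans[OF sum_abs] sum_mono)
       (auto simp: abs_mult intro!: mult_left_mono approx_error_ge assms(2))
  also have "\<dots> = A * approx_error N \<zeta> q"
    by (simp add: A_def sum_distrib_right)
  also have "\<dots> \<le> A * real t powr - \<eta>"
    using q(2) by (intro mult_left_mono) (auto simp: A_def intro: sum_nonneg)
  also have "\<dots> < \<bar>F\<bar>" by (fact t(1))
  also have "\<dots> \<le> \<bar>real q * F\<bar>"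
    using q(1) F by (simp add: abs_mult)
  finally have "(\<Sum>i\<le>N. real_of_int (a i) * real_of_int (approx_point \<zeta> q i)) \<noteq> 0"
    by auto
  hence "(\<Sum>i\<le>N. a i * approx_point \<zeta> q i) \<noteq> 0"
    by (metis (mono_tags, lifting) of_int_eq_0_iff of_int_mult of_int_sum sum.cong)
  thus ?thesis using t(2) unfolding q_def by blast
qed

lemma approx_point_bound:
  assumes "i \<le> N" "q \<ge> 1"
  shows "\<bar>real_of_int (approx_point \<zeta> q i)\<bar> \<le> ((1 + \<bar>\<zeta>\<bar>) ^ N + 1) * real q"
proof -
  have "\<bar>real_of_int (approx_point \<zeta> q i) - \<zeta> ^ i * real q\<bar> \<le> 1 / 2"
    unfolding approx_point_def by (rule of_int_round_abs_le)
  hence "\<bar>real_of_int (approx_point \<zeta> q i)\<bar> \<le> \<bar>\<zeta> ^ i * real q\<bar> + 1 / 2"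
    by linarith
  also have "\<bar>\<zeta> ^ i * real q\<bar> \<le> (1 + \<bar>\<zeta>\<bar>) ^ N * real q"
  proof -
    have "\<bar>\<zeta>\<bar> ^ i \<le> (1 + \<bar>\<zeta>\<bar>) ^ i"
      by (intro power_mono) auto
    also have "\<dots> \<le> (1 + \<bar>\<zeta>\<bar>) ^ N"
      using assms(1) by (intro power_increasing) auto
    finally show ?thesis
      by (simp add: abs_mult power_abs mult_right_mono)
  qed
  finally show ?thesis
    using assms(2) by (simp add: algebra_simps)
qed

text \<open>The points \<open>w 0, \<dots>, w N\<close> of an escaping chain have a non-zero integer determinant. Subtract
  from each new point \<open>y\<close> the multiple \<open>(y\<^sub>0 / x\<^sub>0) x\<close> of the point \<open>x\<close> just before it, which is in the span of
  the earlier rows. The result has first coordinate \<open>0\<close>, and all its other coordinates are at most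
  twice \<open>y\<^sub>0 / x\<^sub>0\<close> times the approximation error of \<open>x\<close>. Since \<open>y\<^sub>0 \<le> j + 1 \<le> 2 j\<close> and the error
  is at most \<open>j powr (- \<eta>)\<close>, this yields the factors of the product. The division by
  \<open>x\<^sub>0\<close> is what a bound by the sizes of the points alone would lose.\<close>

lemma best_approx_det_inequality:
  assumes "\<not> algebraic \<zeta>" "N \<ge> 1" "\<eta> > 0"
      and unif: "\<And>t. t \<ge> T \<Longrightarrow> approx_error N \<zeta> (best_approx N \<zeta> t) \<le> real t powr - \<eta>"
      and s: "s \<ge> T" "s \<ge> 1"
  shows "\<exists>j. (\<forall>k<N. s \<le> j k) \<and> (\<forall>k. 0 < k \<and> k < N \<longrightarrow> j 0 < best_approx N \<zeta> (j k)) \<and>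
    1 \<le> fact (Suc N) * (((1 + \<bar>\<zeta>\<bar>) ^ N + 1) * real (best_approx N \<zeta> s)) *
       (\<Prod>k<N. 4 * real (j k) powr (1 - \<eta>) / real (best_approx N \<zeta> (j k)))"
proof -
  define q where "q = best_approx N \<zeta>"
  define x where "x = (\<lambda>t. approx_point \<zeta> (q t))"
  have "\<exists>t\<ge>s. (\<Sum>i\<le>N. a i * x t i) \<noteq> 0" if "\<exists>i\<le>N. a i \<noteq> 0" for a s
    unfolding x_def q_def
    by (rule best_approx_escapes_hyperplanes[OF assms(1-3) unif that])
  hence "\<exists>j w. w 0 = x s \<and> (\<forall>k<N. w (Suc k) = x (Suc (j k)) \<and> s \<le> j k \<and> (0 < k \<longrightarrow> j 0 < j k) \<and>
           in_span N (Suc k) w (x (j k)) \<and> \<not> in_span N (Suc k) w (w (Suc k)))"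
    by (rule escaping_chain)
  then obtain j w where w0: "w 0 = x s" and wS: "\<And>k. k < N \<Longrightarrow> w (Suc k) = x (Suc (j k))"
    and js: "\<And>k. k < N \<Longrightarrow> s \<le> j k" and j0: "\<And>k. 0 < k \<Longrightarrow> k < N \<Longrightarrow> j 0 < j k"
    and ins: "\<And>k. k < N \<Longrightarrow> in_span N (Suc k) w (x (j k))"
    and out: "\<And>k. k < N \<Longrightarrow> \<not> in_span N (Suc k) w (w (Suc k))"
    by blast
  have changed: "q (j k) \<noteq> q (Suc (j k))" if "k < N" for k
    using ins[OF that] out[OF that] wS[OF that] unfolding x_def by metis
  have j1: "j k \<ge> 1" if "k < N" for k
    using js[OF that] s(2) by linarith
  \<comment> \<open>the best denominator changes at \<open>j 0\<close>, so by stability all later ones exceed \<open>j 0\<close>\<close>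
  have big: "j 0 < q (j k)" if "0 < k" "k < N" for k
  proof (rule ccontr)
    assume "\<not> ?thesis"
    hence le: "q (j k) \<le> j 0" by simp
    have N0: "0 < N" using that by simp
    have "q (j 0) = q (j k)"
      unfolding q_def using le j0[OF that] j1[OF N0] by (intro best_approx_stable) (auto simp: q_def)
    moreover have "q (Suc (j 0)) = q (j k)"
      unfolding q_def using le j0[OF that] by (intro best_approx_stable) (auto simp: q_def)
    ultimately show False using changed[OF N0] by simp
  qed
  define W where "W = mat (Suc N) (Suc N) (\<lambda>(k, i). w k i)"
  have "det W \<noteq> 0"
    unfolding W_def
  proof (rule det_nonzero_if_escaping)
    fix k assume k: "k \<le> N"
    show "\<not> in_span N k w (w k)"
    proof (cases k)
      case 0
      have "w 0 0 \<noteq> 0"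
        using best_approx_pos[OF s(2), of N \<zeta>] by (simp add: w0 x_def q_def)
      thus ?thesis by (auto simp: 0 in_span_def)
    next
      case (Suc k')
      thus ?thesis using out[of k'] k by simp
    qed
  qed
  hence "1 \<le> \<bar>det W\<bar>" by linarith
  hence "1 \<le> \<bar>real_of_int (det W)\<bar>"
    by (metis of_int_1_le_iff of_int_abs)
  also have "real_of_int (det W) = det (mat (Suc N) (Suc N) (\<lambda>(k, i). real_of_int (w k i)))"
    unfolding of_int_hom.hom_det[symmetric] by (rule arg_cong[of _ _ det]) (auto simp: W_def)
  also obtain c where c: "\<And>k i. k < N \<Longrightarrow> i \<le> N \<Longrightarrow> real_of_int (x (j k) i) = (\<Sum>l<Suc k. c k l * real_of_int (w l i))"
    using ins unfolding in_span_def by metis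
  define r where "r = (\<lambda>k. real (q (Suc (j k))) / real (q (j k)))"
  define d where "d = (\<lambda>k l. case k of 0 \<Rightarrow> 0 | Suc k \<Rightarrow> r k * c k l)"
  define z where "z = (\<lambda>k i. real_of_int (w k i) - (\<Sum>l<k. d k l * real_of_int (w l i)))"
  have "det (mat (Suc N) (Suc N) (\<lambda>(k, i). real_of_int (w k i))) = det (mat (Suc N) (Suc N) (\<lambda>(k, i). z k i))"
    by (rule det_unitriangular_rows[of _ _ _ d, symmetric]) (simp add: z_def)
  also define b where "b = (\<lambda>k. case k of 0 \<Rightarrow> ((1 + \<bar>\<zeta>\<bar>) ^ N + 1) * real (q s)
                           | Suc k \<Rightarrow> 4 * real (j k) powr (1 - \<eta>) / real (q (j k)))"
  have bound: "\<bar>z k i\<bar> \<le> b k" if k: "k \<le> N" and i: "i \<le> N" for k i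
  proof (cases k)
    case 0
    have "q s \<ge> 1" unfolding q_def by (rule best_approx_pos[OF s(2)])
    with approx_point_bound[OF i this, of \<zeta>] show ?thesis
      by (simp add: 0 z_def w0 x_def b_def)
  next
    case (Suc k')
    hence k': "k' < N" using k by simp
    define t where "t = j k'"
    have t: "t \<ge> 1" "t \<ge> T" using j1[OF k'] js[OF k'] s by (auto simp: t_def)
    have qt: "q t \<ge> 1" "q t \<le> q (Suc t)" "q t \<le> t" "q (Suc t) \<le> Suc t"
      unfolding q_def using t(1) by (auto intro: best_approx_pos[simplified] best_approx_mono best_approx_le)
    have e: "approx_error N \<zeta> (q t) \<le> real t powr - \<eta>"
      unfolding q_def by (rule unif[OF t(2)])
    have e': "approx_error N \<zeta> (q (Suc t)) \<le> approx_error N \<zeta> (q t)"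
      unfolding q_def using qt by (intro best_approx_minimal) (auto simp: q_def)
    have r1: "r k' \<ge> 1"
      using qt by (simp add: r_def t_def[symmetric])
    have "(\<Sum>l<k. d k l * real_of_int (w l i)) = r k' * real_of_int (x t i)"
      unfolding t_def c[OF k' i] sum_distrib_left Suc by (simp add: d_def mult.assoc)
    hence "z k i = real_of_int (x (Suc t) i) - r k' * real_of_int (x t i)"
      by (simp add: z_def Suc wS[OF k'] t_def)
    also have "\<dots> = r k' * (\<zeta> ^ i * real (q t) - real_of_int (x t i)) - (\<zeta> ^ i * real (q (Suc t)) - real_of_int (x (Suc t) i))"
      using qt by (simp add: r_def t_def[symmetric] field_simps)
    also have "\<bar>\<dots>\<bar> \<le> r k' * approx_error N \<zeta> (q t) + approx_error N \<zeta> (q (Suc t))"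
    proof -
      have "\<bar>r k' * (\<zeta> ^ i * real (q t) - real_of_int (x t i))\<bar> \<le> r k' * approx_error N \<zeta> (q t)"
        unfolding abs_mult x_def using r1 by (auto intro!: mult_mono approx_error_ge i assms(2))
      moreover have "\<bar>\<zeta> ^ i * real (q (Suc t)) - real_of_int (x (Suc t) i)\<bar> \<le> approx_error N \<zeta> (q (Suc t))"
        unfolding x_def by (intro approx_error_ge i assms(2))
      ultimately show ?thesis by linarith
    qed
    also have "\<dots> \<le> 2 * r k' * approx_error N \<zeta> (q t)"
    proof -
      have "1 * approx_error N \<zeta> (q t) \<le> r k' * approx_error N \<zeta> (q t)"
        using r1 approx_error_nonneg[OF assms(2)] by (intro mult_right_mono) auto
      thus ?thesis using e' by simp
    qed
    also have "\<dots> \<le> 2 * r k' * real t powr - \<eta>"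
      using e r1 by (intro mult_left_mono) auto
    also have "\<dots> \<le> 2 * (2 * real t / real (q t)) * real t powr - \<eta>"
      using qt t(1) by (intro mult_right_mono mult_left_mono) (auto simp: r_def t_def[symmetric] intro!: divide_right_mono)
    also have "\<dots> = 4 * (real t powr 1 * real t powr - \<eta>) / real (q t)"
      using t(1) by simp
    also have "\<dots> = 4 * real t powr (1 - \<eta>) / real (q t)"
      unfolding powr_add[symmetric] by simp
    finally show ?thesis by (simp add: Suc b_def t_def)
  qed
  have "\<bar>det (mat (Suc N) (Suc N) (\<lambda>(k, i). z k i))\<bar> \<le> fact (Suc N) * (\<Prod>k<Suc N. b k)"
    by (rule abs_det_le) (auto intro!: bound)
  also have "(\<Prod>k<Suc N. b k) = b 0 * (\<Prod>k<N. b (Suc k))"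
    by (rule prod.lessThan_Suc_shift)
  finally have "1 \<le> fact (Suc N) * (b 0 * (\<Prod>k<N. b (Suc k)))" .
  thus ?thesis
    using js big by (intro exI[of _ j]) (auto simp: q_def b_def mult.assoc)
qed

text \<open>Approximability at every scale forces better approximability at infinitely many scales. If the
  claim failed, the error bound at \<open>j\<close> would give \<open>j powr (1 - \<eta>) \<le> q powr (1 - \<delta>)\<close> for the best
  denominator \<open>q\<close> at \<open>j\<close>. So in the determinant inequality each of the last \<open>N - 1\<close> factors is at
  most \<open>4 q powr (- \<delta>)\<close> with \<open>q > j 0\<close>, while the first factor times the best denominator at \<open>s\<close> is at most
  \<open>4 (j 0) powr (1 - \<eta>)\<close>. The total exponent \<open>1 - \<eta> - (N - 1) \<delta>\<close> is negative, but the
  product is bounded below. As \<open>\<delta>\<close> decreases to \<open>(1 - \<eta>) / (N - 1)\<close>, the exponent in the conclusion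
  tends to \<open>\<eta> (\<eta> + N - 2) / ((N - 1) (1 - \<eta>))\<close>, the lower bound of Schmidt and Summerer.\<close>

lemma uniform_imp_ordinary_exponent:
  assumes "\<not> algebraic \<zeta>" "N \<ge> 2" "0 < \<eta>" "\<eta> < 1"
      and \<delta>: "1 - \<eta> < real (N - 1) * \<delta>" "\<delta> < 1"
      and unif: "\<And>t. t \<ge> T \<Longrightarrow> approx_error N \<zeta> (best_approx N \<zeta> t) \<le> real t powr - \<eta>"
  shows "\<exists>q\<ge>Q. approx_error N \<zeta> q < real q powr - (\<eta> * (1 - \<delta>) / (1 - \<eta>))"
proof (rule ccontr)
  assume neg: "\<not> ?thesis"
  define q where "q = best_approx N \<zeta>"
  define C where "C = fact (Suc N) * ((1 + \<bar>\<zeta>\<bar>) ^ N + 1) * 4 ^ N"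
  have "C > 0" by (simp add: C_def add_pos_nonneg)
  define e where "e = real (N - 1) * \<delta> - (1 - \<eta>)"
  have "e > 0" using \<delta> by (simp add: e_def)
  have "\<delta> > 0"
    using \<delta>(1) assms(4) by (smt (verit) mult_nonneg_nonpos of_nat_0_le_iff)
  have "(\<lambda>t :: nat. C * real t powr - e) \<longlonglongrightarrow> C * 0"
    using \<open>e > 0\<close> by (intro tendsto_mult tendsto_const tendsto_neg_powr filterlim_real_sequentially) auto
  hence "\<forall>\<^sub>F t in sequentially. C * real t powr - e < 1"
    by (intro order_tendstoD(2)) auto
  then obtain S where S: "\<And>t. t \<ge> S \<Longrightarrow> C * real t powr - e < 1"
    unfolding eventually_sequentially by blast
  define s where "s = Max {1, T, S, Q}"
  have s: "s \<ge> 1" "s \<ge> T" "s \<ge> S" "s \<ge> Q" by (auto simp: s_def)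
  have "N \<ge> 1" using assms(2) by simp
  from best_approx_det_inequality[OF assms(1) this assms(3) unif s(2,1)]
  obtain j where j: "\<And>k. k < N \<Longrightarrow> s \<le> j k" "\<And>k. 0 < k \<Longrightarrow> k < N \<Longrightarrow> j 0 < q (j k)"
    "1 \<le> fact (Suc N) * (((1 + \<bar>\<zeta>\<bar>) ^ N + 1) * real (q s)) *
       (\<Prod>k<N. 4 * real (j k) powr (1 - \<eta>) / real (q (j k)))"
    unfolding q_def by blast
  obtain N' where N': "N = Suc N'" using assms(2) by (cases N) auto
  have j0: "s \<le> j 0" "1 \<le> j 0" using j(1)[of 0] s N' by auto
  have q0: "1 \<le> q (j 0)" "q s \<le> q (j 0)"
    unfolding q_def using j0 s best_approx_pos[of "j 0" N \<zeta>] by (auto intro: best_approx_mono)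
  have factor: "real (j k) powr (1 - \<eta>) / real (q (j k)) \<le> real (j 0) powr - \<delta>" if k: "0 < k" "k < N" for k
  proof -
    have jk: "j k \<ge> 1" "j k \<ge> T" using j(1)[OF k(2)] s by auto
    have qk: "q (j k) \<ge> 1" "q (j k) \<ge> Q" "j 0 \<le> q (j k)"
      using j(2)[OF k] j0 s by auto
    have "real (q (j k)) powr - (\<eta> * (1 - \<delta>) / (1 - \<eta>)) \<le> approx_error N \<zeta> (q (j k))"
      using neg qk(2) by (meson not_less)
    also have "\<dots> \<le> real (j k) powr - \<eta>"
      unfolding q_def by (rule unif[OF jk(2)])
    finally have "(real (q (j k)) powr - (\<eta> * (1 - \<delta>) / (1 - \<eta>))) powr - ((1 - \<eta>) / \<eta>) \<ge> (real (j k) powr - \<eta>) powr - ((1 - \<eta>) / \<eta>)"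
      using assms(3,4) qk(1) by (intro powr_mono2') auto
    hence "real (j k) powr (1 - \<eta>) \<le> real (q (j k)) powr (1 - \<delta>)"
      unfolding powr_powr using assms(3,4) by simp
    hence "real (j k) powr (1 - \<eta>) / real (q (j k)) \<le> real (q (j k)) powr (1 - \<delta>) / real (q (j k))"
      by (intro divide_right_mono) auto
    also have "\<dots> = real (q (j k)) powr - \<delta>"
      using qk(1) by (simp add: powr_diff powr_minus field_simps)
    also have "\<dots> \<le> real (j 0) powr - \<delta>"
      using j0 qk \<open>\<delta> > 0\<close> by (intro powr_mono2') auto
    finally show ?thesis .
  qed
  have "(\<Prod>k<N. 4 * real (j k) powr (1 - \<eta>) / real (q (j k))) =
        4 ^ N * (\<Prod>k<N. real (j k) powr (1 - \<eta>) / real (q (j k)))"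
    by (simp add: prod.distrib flip: times_divide_eq_right)
  also have "(\<Prod>k<N. real (j k) powr (1 - \<eta>) / real (q (j k))) =
     real (j 0) powr (1 - \<eta>) / real (q (j 0)) * (\<Prod>k<N'. real (j (Suc k)) powr (1 - \<eta>) / real (q (j (Suc k))))"
    unfolding N' by (rule prod.lessThan_Suc_shift)
  finally have "1 \<le> C * (real (q s) / real (q (j 0))) * (real (j 0) powr (1 - \<eta>) * (\<Prod>k<N'. real (j (Suc k)) powr (1 - \<eta>) / real (q (j (Suc k)))))"
    using j(3) by (simp add: C_def mult_ac)
  also have "\<dots> \<le> C * 1 * (real (j 0) powr (1 - \<eta>) * (\<Prod>k<N'. real (j 0) powr - \<delta>))"
    using q0 \<open>C > 0\<close> N' by (intro mult_mono mult_left_mono prod_mono mult_nonneg_nonneg prod_nonneg conjI factor) auto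
  also have "(\<Prod>k<N'. real (j 0) powr - \<delta>) = real (j 0) powr - (real N' * \<delta>)"
    using j0 by (simp add: powr_power mult.commute)
  also have "C * 1 * (real (j 0) powr (1 - \<eta>) * \<dots>) = C * real (j 0) powr - e"
    unfolding powr_add[symmetric] by (simp add: e_def N')
  also have "\<dots> < 1"
    using S j0 s by simp
  finally show False by simp
qed

section \<open>Integer polynomials with small values\<close>

text \<open>Dirichlet's box principle: the \<open>(B + 1)\<^sup>m\<^sup>+\<^sup>1\<close> combinations with coefficients in \<open>{0..B}\<close> have
  values in an interval of length \<open>2 V\<close>, which is cut into \<open>B\<^sup>m\<^sup>+\<^sup>1\<close> boxes (and one more for its right
  end point). The difference of two combinations in one box is the required polynomial.\<close>

lemma small_integer_combination:
  fixes \<theta> :: "nat \<Rightarrow> real"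
  assumes "\<And>i. i \<le> m \<Longrightarrow> \<bar>\<theta> i\<bar> \<le> C" "C > 0" "m \<ge> 1" "B \<ge> 1"
  shows "\<exists>f :: int poly. f \<noteq> 0 \<and> degree f \<le> m \<and> (\<forall>i. \<bar>coeff f i\<bar> \<le> int B) \<and>
    \<bar>\<Sum>i\<le>m. real_of_int (coeff f i) * \<theta> i\<bar> < 4 * real (Suc m) * C / real B ^ m"
proof -
  define V where "V = real (Suc m) * C * real B"
  define h where "h = 2 * V / real B ^ Suc m"
  have V: "V > 0" and h: "h > 0"
    using assms by (simp_all add: V_def h_def)
  define F where "F = (\<lambda>p :: nat \<Rightarrow> nat. \<Sum>i\<le>m. real (p i) * \<theta> i)"
  define X where "X = PiE {..m} (\<lambda>_. {0..B})"
  have F: "\<bar>F p\<bar> \<le> V" if "p \<in> X" for p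
  proof -
    have "\<bar>F p\<bar> \<le> (\<Sum>i\<le>m. \<bar>real (p i) * \<theta> i\<bar>)"
      unfolding F_def by (rule sum_abs)
    also have "\<dots> \<le> (\<Sum>i\<le>m. real B * C)"
      using that assms(1) unfolding X_def abs_mult by (intro sum_mono mult_mono) (auto simp: PiE_iff)
    also have "\<dots> = V" by (simp add: V_def)
    finally show ?thesis .
  qed
  define box where "box = (\<lambda>p. \<lfloor>(F p + V) / h\<rfloor>)"
  have "box ` X \<subseteq> {0..int (B ^ Suc m)}"
  proof
    fix y assume "y \<in> box ` X"
    then obtain p where p: "p \<in> X" "y = box p" by blast
    have "0 \<le> (F p + V) / h" "(F p + V) / h \<le> 2 * V / h"
      using F[OF p(1)] h by (auto intro!: divide_right_mono)
    moreover have "2 * V / h = real (B ^ Suc m)"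
      using V assms(4) by (simp add: h_def)
    ultimately show "y \<in> {0..int (B ^ Suc m)}"
      unfolding p(2) box_def by (auto simp: le_floor_iff floor_le_iff)
  qed
  hence "card (box ` X) \<le> card {0..int (B ^ Suc m)}"
    by (intro card_mono) auto
  also have "\<dots> < card X"
  proof -
    have "B ^ Suc m + 1 < (B + 1) ^ Suc m"
    proof -
      have "B ^ Suc m + B ^ m \<le> (B + 1) * B ^ m" by simp
      also have "\<dots> < (B + 1) * (B + 1) ^ m"
        using assms(3) by (intro mult_strict_left_mono power_strict_mono) auto
      finally have "B ^ Suc m + B ^ m < (B + 1) ^ Suc m" by simp
      moreover have "1 \<le> B ^ m" using assms(4) by simp
      ultimately show ?thesis by linarith
    qed
    moreover have "card {0..int K} = K + 1" for K by simp
    moreover have "card X = (B + 1) ^ Suc m"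
      by (simp add: X_def card_PiE)
    ultimately show ?thesis by (simp only:)
  qed
  finally have "\<not> inj_on box X"
    using card_image by fastforce
  then obtain p p' where p: "p \<in> X" "p' \<in> X" "p \<noteq> p'" "box p = box p'"
    unfolding inj_on_def by blast
  define f where "f = (\<Sum>i\<le>m. monom (int (p i) - int (p' i)) i)"
  have coeff: "coeff f i = (if i \<le> m then int (p i) - int (p' i) else 0)" for i
    by (simp add: f_def coeff_sum)
  show ?thesis
  proof (intro exI[of _ f] conjI allI)
    obtain i where "i \<le> m" "p i \<noteq> p' i"
      using p(1-3) unfolding X_def by (metis PiE_ext atMost_iff)
    hence "coeff f i \<noteq> 0" by (simp add: coeff)
    thus "f \<noteq> 0" by auto
    show "degree f \<le> m" by (rule degree_le) (simp add: coeff)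
    show "\<bar>coeff f i\<bar> \<le> int B" for i
      using p(1,2) by (force simp: coeff X_def PiE_iff)
    have "(\<Sum>i\<le>m. real_of_int (coeff f i) * \<theta> i) = F p - F p'"
      by (simp add: coeff F_def sum_subtractf algebra_simps)
    also have "\<bar>F p - F p'\<bar> < h"
    proof -
      have "\<bar>(F p + V) / h - (F p' + V) / h\<bar> < 1"
        using p(4) unfolding box_def by linarith
      also have "(F p + V) / h - (F p' + V) / h = (F p - F p') / h"
        using h by (simp add: field_simps)
      finally show ?thesis using h by (simp add: abs_divide)
    qed
    also have "h \<le> 4 * real (Suc m) * C / real B ^ m"
      using assms(2,4) by (simp add: h_def V_def divide_simps)
    finally show "\<bar>\<Sum>i\<le>m. real_of_int (coeff f i) * \<theta> i\<bar> < 4 * real (Suc m) * C / real B ^ m" .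
  qed
qed

lemma poly_of_int_poly_eq_sum:
  fixes z :: real
  assumes "degree f \<le> m"
  shows "poly (of_int_poly f) z = (\<Sum>i\<le>m. real_of_int (coeff f i) * z ^ i)"
proof -
  have "poly (of_int_poly f) z = (\<Sum>i\<le>degree f. real_of_int (coeff f i) * z ^ i)"
    by (simp add: poly_altdef)
  also have "\<dots> = (\<Sum>i\<le>m. real_of_int (coeff f i) * z ^ i)"
    using assms by (intro sum.mono_neutral_left) (auto simp: coeff_eq_0)
  finally show ?thesis .
qed

lemma mahler_measure_mult:
  "mahler_measure (f * g) = mahler_measure f * mahler_measure g"
  unfolding mahler_measure_def of_int_poly_hom.hom_mult by (rule measure_eq_prod)

lemma mahler_measure_le_height:
  assumes "degree f \<le> m" "\<And>i. \<bar>coeff f i\<bar> \<le> int B"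
  shows "mahler_measure f \<le> real (Suc m) * real B"
proof -
  have "(\<Sum>a\<leftarrow>coeffs f. a * a) \<le> (\<Sum>a\<leftarrow>coeffs f. int B * int B)"
  proof (rule sum_list_mono)
    fix a assume "a \<in> set (coeffs f)"
    then obtain i where "a = coeff f i" unfolding coeffs_def by (auto split: if_splits)
    hence "\<bar>a\<bar> * \<bar>a\<bar> \<le> int B * int B"
      using assms(2) by (intro mult_mono) auto
    thus "a * a \<le> int B * int B" by simp
  qed
  also have "\<dots> = int (length (coeffs f)) * (int B * int B)"
    by (simp add: sum_list_triv)
  also have "\<dots> \<le> int (Suc m) * (int B * int B)"
    using assms(1) by (intro mult_right_mono) (auto simp: length_coeffs_degree coeffs_def)
  finally have "real_of_int (\<Sum>a\<leftarrow>coeffs f. a * a) \<le> real_of_int (int (Suc m) * (int B * int B))"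
    by (simp only: of_int_le_iff)
  hence "sqrt (real_of_int (\<Sum>a\<leftarrow>coeffs f. a * a)) \<le> sqrt (real (Suc m) * (real B)\<^sup>2)"
    by (simp add: power2_eq_square)
  also have "\<dots> \<le> sqrt ((real (Suc m) * real B)\<^sup>2)"
    unfolding power_mult_distrib by (intro real_sqrt_le_mono mult_right_mono) (auto simp: power2_eq_square)
  also have "\<dots> = real (Suc m) * real B" by simp
  finally show ?thesis
    using Landau_inequality_mahler_measure[of f] by linarith
qed

lemma coeff_le_mahler_measure:
  assumes "degree f \<le> m"
  shows "\<bar>real_of_int (coeff f i)\<bar> \<le> 2 ^ m * mahler_measure f"
proof -
  have "\<bar>real_of_int (coeff f i)\<bar> \<le> real (degree f choose i) * mahler_measure f"
    using Mignotte_bound[of f i] by simp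
  also have "degree f choose i \<le> 2 ^ m"
    using binomial_le_pow2[of "degree f" i] power_increasing[OF assms, of "2::nat"] by linarith
  hence "real (degree f choose i) * mahler_measure f \<le> real (2 ^ m) * mahler_measure f"
    by (intro mult_right_mono mahler_measure_ge_0) (simp only: of_nat_le_iff)
  finally show ?thesis by simp
qed

text \<open>Only finitely many integer polynomials have bounded degree and bounded Mahler measure, and none
  of them vanishes at a transcendental number. Hence a small value forces a large Mahler measure.\<close>

lemma value_bounded_below:
  assumes "\<not> algebraic (\<zeta> :: real)"
  obtains \<epsilon> where "\<epsilon> > 0"
    "\<And>f :: int poly. f \<noteq> 0 \<Longrightarrow> degree f \<le> m \<Longrightarrow> mahler_measure f \<le> M \<Longrightarrow> \<epsilon> \<le> \<bar>poly (of_int_poly f) \<zeta>\<bar>"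
proof -
  define S where "S = {f :: int poly. f \<noteq> 0 \<and> degree f \<le> m \<and> mahler_measure f \<le> M}"
  define K where "K = \<lfloor>2 ^ m * M\<rfloor>"
  have "S \<subseteq> Poly ` {xs. set xs \<subseteq> {-K..K} \<and> length xs \<le> Suc m}"
  proof
    fix f assume f: "f \<in> S"
    have "\<bar>coeff f i\<bar> \<le> K" for i
    proof -
      have "\<bar>real_of_int (coeff f i)\<bar> \<le> 2 ^ m * mahler_measure f"
        using f by (intro coeff_le_mahler_measure) (simp add: S_def)
      also have "\<dots> \<le> 2 ^ m * M"
        using f by (simp add: S_def)
      finally show ?thesis unfolding K_def by (simp add: le_floor_iff)
    qed
    hence "coeff f i \<in> {-K..K}" for i
      by (metis abs_le_iff atLeastAtMost_iff minus_le_iff)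
    hence "set (coeffs f) \<subseteq> {-K..K}"
      unfolding coeffs_def by auto
    moreover have "length (coeffs f) \<le> Suc m"
      using f by (simp add: S_def length_coeffs_degree)
    ultimately show "f \<in> Poly ` {xs. set xs \<subseteq> {-K..K} \<and> length xs \<le> Suc m}"
      by (intro image_eqI[of _ _ "coeffs f"]) auto
  qed
  hence fin: "finite S"
    by (rule finite_subset) (intro finite_imageI finite_lists_length_le, simp)
  define \<epsilon> where "\<epsilon> = Min (insert 1 ((\<lambda>f. \<bar>poly (of_int_poly f) \<zeta>\<bar>) ` S))"
  show ?thesis
  proof (rule that[of \<epsilon>])
    have "poly (of_int_poly f) \<zeta> \<noteq> 0" if "f \<in> S" for f
      using assms that by (auto simp: S_def intro!: algebraicI[of "of_int_poly f"])
    thus "\<epsilon> > 0"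
      unfolding \<epsilon>_def using fin by (subst Min_gr_iff) auto
  next
    fix f :: "int poly" assume "f \<noteq> 0" "degree f \<le> m" "mahler_measure f \<le> M"
    hence "f \<in> S" by (simp add: S_def)
    thus "\<epsilon> \<le> \<bar>poly (of_int_poly f) \<zeta>\<bar>"
      unfolding \<epsilon>_def using fin by (intro Min_le) auto
  qed
qed

text \<open>The quantity \<open>\<bar>f(\<zeta>)\<bar> M(f)\<^sup>w / \<delta>\<^sup>d\<close> with \<open>d\<close> the degree of \<open>f\<close> is multiplicative, since the Mahler
  measure is, and it is at least \<open>1\<close> on non-zero constants. If it is below \<open>1\<close> for a
  product, it is below \<open>1\<close> for some prime factor of positive degree. The power of \<open>\<delta>\<close> distributes the smallness of \<open>f(\<zeta>)\<close> over the factors, so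
  that the factor found also has a small value.\<close>

lemma prime_factor_small:
  fixes \<zeta> w \<delta> :: real
  assumes "f \<noteq> 0" "w \<ge> 0" "0 < \<delta>" "\<delta> < 1"
      and "\<bar>poly (of_int_poly f) \<zeta>\<bar> * mahler_measure f powr w < \<delta> ^ degree f"
  obtains g :: "int poly" where "prime_elem g" "g dvd f" "degree g \<ge> 1"
    "\<bar>poly (of_int_poly g) \<zeta>\<bar> * mahler_measure g powr w < \<delta>"
proof -
  define G where "G = (\<lambda>f :: int poly. \<bar>poly (of_int_poly f) \<zeta>\<bar> * mahler_measure f powr w / \<delta> ^ degree f)"
  have G_mult: "G (f * g) = G f * G g" if "f \<noteq> 0" "g \<noteq> 0" for f g
    using that by (simp add: G_def abs_mult mahler_measure_mult powr_mult mahler_measure_ge_0 degree_mult_eq power_add of_int_poly_hom.hom_mult)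
  have G_const: "G [:c:] \<ge> 1" if "c \<noteq> 0" for c
  proof -
    have "mahler_measure [:c:] \<ge> 1"
      using that by (intro mahler_measure_poly_ge_1) simp
    hence "1 \<le> mahler_measure [:c:] powr w"
      using assms(2) by (simp add: ge_one_powr_ge_zero)
    moreover have "1 \<le> \<bar>real_of_int c\<bar>"
      using that by linarith
    ultimately have "1 * 1 \<le> \<bar>real_of_int c\<bar> * mahler_measure [:c:] powr w"
      by (intro mult_mono) auto
    thus ?thesis using that by (simp add: G_def map_poly_pCons)
  qed
  have "\<exists>g. prime g \<and> g dvd f \<and> G g < 1" if "f \<noteq> 0" "G f < 1" for f
    using that
  proof (induction f rule: prime_divisors_induct)
    case zero
    thus ?case by simp
  next
    case (unit f)
    then obtain c where "f = [:c:]" "c \<noteq> 0"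
      by (metis is_unit_poly_iff not_is_unit_0)
    with G_const[of c] unit show ?case by simp
  next
    case (factor p f)
    hence nz: "p \<noteq> 0" "f \<noteq> 0" by auto
    have "G p \<ge> 0" "G f \<ge> 0"
      using assms(3) by (auto simp: G_def)
    with factor.prems(2) have "G p < 1 \<or> G f < 1"
      unfolding G_mult[OF nz] by (metis mult_mono' mult_1 not_less zero_le_one)
    thus ?case
      using factor nz by (auto intro: dvd_mult)
  qed
  moreover have "G f < 1"
    using assms by (simp add: G_def)
  ultimately obtain g where g: "prime g" "g dvd f" "G g < 1"
    using assms(1) by blast
  show ?thesis
  proof (rule that[of g])
    show "prime_elem g" "g dvd f" using g by auto
    show "degree g \<ge> 1"
    proof (rule ccontr)
      assume "\<not> ?thesis"
      then obtain c where c: "g = [:c:]" by (metis degree_eq_zeroE less_one not_le)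
      with g have "c \<noteq> 0" by auto
      with G_const[of c] g(3) c show False by simp
    qed
    hence "\<delta> ^ degree g \<le> \<delta>"
      using assms(3,4) power_decreasing[of 1 "degree g" \<delta>] by simp
    thus "\<bar>poly (of_int_poly g) \<zeta>\<bar> * mahler_measure g powr w < \<delta>"
      using g(3) assms(3) by (simp add: G_def field_simps)
  qed
qed

text \<open>Khintchine's transference principle. Given a good denominator \<open>q\<close>, the box principle gives
  integers \<open>f\<^sub>0, \<dots>, f\<^sub>n\<close> of size \<open>q powr (1 / n)\<close> for which \<open>\<Sum> f\<^sub>i x\<^sub>i\<close> is smaller than \<open>1\<close>, hence zero.
  Then \<open>q f(\<zeta>)\<close> is a combination of the errors only, of size \<open>q powr (1 / n - \<alpha>)\<close>.\<close>

lemma khintchine_transference: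
  fixes \<zeta> \<alpha> w \<epsilon> :: real and x :: "nat \<Rightarrow> nat \<Rightarrow> int"
  assumes "n \<ge> 1" "\<epsilon> > 0" "w \<ge> 0" "w < real n - 1 + real n * \<alpha>" "C > 0"
      and appr: "\<And>Q. \<exists>q\<ge>Q. \<forall>i\<le>n. \<bar>\<zeta> ^ i * real q - real_of_int (x q i)\<bar> \<le> real q powr - \<alpha>"
      and bounded: "\<And>q i. q \<ge> 1 \<Longrightarrow> i \<le> n \<Longrightarrow> \<bar>real_of_int (x q i)\<bar> \<le> C * real q"
  shows "\<exists>f :: int poly. f \<noteq> 0 \<and> degree f \<le> n \<and> \<bar>poly (of_int_poly f) \<zeta>\<bar> * mahler_measure f powr w < \<epsilon>"
proof -
  define D where "D = 2 * (4 * real (Suc n) * (C + 1)) powr (1 / real n)"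
  define \<kappa> where "\<kappa> = 1 + \<alpha> - (1 + w) / real n"
  define E where "E = real (Suc n) * D * (real (Suc n) * D) powr w"
  have "D > 0" using assms(5) by (simp add: D_def)
  have "\<kappa> > 0" using assms(1,4) by (simp add: \<kappa>_def field_simps)
  have "((\<lambda>q :: nat. E * real q powr - \<kappa>) \<longlongrightarrow> E * 0) sequentially"
    using \<open>\<kappa> > 0\<close> by (intro tendsto_mult tendsto_const tendsto_neg_powr filterlim_real_sequentially) auto
  hence "\<forall>\<^sub>F q in sequentially. E * real q powr - \<kappa> < \<epsilon>"
    using assms(2) by (intro order_tendstoD(2)) auto
  then obtain Q where Q: "\<And>q. q \<ge> Q \<Longrightarrow> E * real q powr - \<kappa> < \<epsilon>"
    unfolding eventually_sequentially by blast
  obtain q where "q \<ge> max 1 Q" and q: "\<And>i. i \<le> n \<Longrightarrow> \<bar>\<zeta> ^ i * real q - real_of_int (x q i)\<bar> \<le> real q powr - \<alpha>"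
    using appr by blast
  hence "q \<ge> 1" "q \<ge> Q" by auto
  define H where "H = (4 * real (Suc n) * (C + 1) * real q) powr (1 / real n)"
  have "1 * 1 * 1 \<le> 4 * real (Suc n) * (C + 1) * real q"
    using \<open>q \<ge> 1\<close> assms(5) by (intro mult_mono) auto
  hence "H \<ge> 1" unfolding H_def by (intro ge_one_powr_ge_zero) auto
  have Hn: "H ^ n = 4 * real (Suc n) * (C + 1) * real q"
    using assms(1,5) \<open>q \<ge> 1\<close> by (simp add: H_def powr_power)
  define B where "B = nat \<lceil>H\<rceil>"
  have B: "H \<le> real B" "real B \<le> 2 * H" "B \<ge> 1"
    using \<open>H \<ge> 1\<close> unfolding B_def by linarith+
  have "2 * H = D * real q powr (1 / real n)"
    using assms(5) by (simp add: H_def D_def powr_mult)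
  with B have BD: "real B \<le> D * real q powr (1 / real n)" by simp
  obtain f :: "int poly" where f: "f \<noteq> 0" "degree f \<le> n" "\<And>i. \<bar>coeff f i\<bar> \<le> int B"
    "\<bar>\<Sum>i\<le>n. real_of_int (coeff f i) * real_of_int (x q i)\<bar> < 4 * real (Suc n) * (C * real q) / real B ^ n"
    using small_integer_combination[of n "\<lambda>i. real_of_int (x q i)", OF bounded[OF \<open>q \<ge> 1\<close>] _ assms(1) B(3)]
      assms(5) \<open>q \<ge> 1\<close> by auto
  have "4 * real (Suc n) * (C * real q) \<le> H ^ n"
    unfolding Hn using \<open>q \<ge> 1\<close> by (simp add: algebra_simps)
  also have "\<dots> \<le> real B ^ n" using B \<open>H \<ge> 1\<close> by (intro power_mono) auto
  finally have "4 * real (Suc n) * (C * real q) / real B ^ n \<le> 1" using B by (simp add: field_simps)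
  with f(4) have "\<bar>real_of_int (\<Sum>i\<le>n. coeff f i * x q i)\<bar> < 1" by simp
  hence "(\<Sum>i\<le>n. coeff f i * x q i) = 0" by linarith
  hence zero: "(\<Sum>i\<le>n. real_of_int (coeff f i) * real_of_int (x q i)) = 0"
    by (metis (mono_tags, lifting) of_int_0 of_int_mult of_int_sum sum.cong)
  have "real q * poly (of_int_poly f) \<zeta> = (\<Sum>i\<le>n. real_of_int (coeff f i) * (\<zeta> ^ i * real q - real_of_int (x q i)))"
    using zero by (simp add: poly_of_int_poly_eq_sum[OF f(2)] sum_distrib_left sum_subtractf algebra_simps)
  also have "\<bar>\<dots>\<bar> \<le> (\<Sum>i\<le>n. real B * real q powr - \<alpha>)"
  proof (intro order_trans[OF sum_abs] sum_mono)
    fix i assume "i \<in> {..n}"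
    thus "\<bar>real_of_int (coeff f i) * (\<zeta> ^ i * real q - real_of_int (x q i))\<bar> \<le> real B * real q powr - \<alpha>"
      using f(3)[of i] unfolding abs_mult by (intro mult_mono q) auto
  qed
  also have "\<dots> = real (Suc n) * real B * real q powr - \<alpha>" by simp
  also have "\<dots> \<le> real (Suc n) * (D * real q powr (1 / real n)) * real q powr - \<alpha>"
    using BD by (intro mult_right_mono mult_left_mono) auto
  finally have "\<bar>poly (of_int_poly f) \<zeta>\<bar> \<le> real (Suc n) * (D * real q powr (1 / real n)) * real q powr - \<alpha> / real q"
    using \<open>q \<ge> 1\<close> by (simp add: abs_mult field_simps)
  also have "\<dots> = real (Suc n) * D * real q powr (1 / real n - \<alpha> - 1)"
    using \<open>q \<ge> 1\<close> by (simp add: powr_diff powr_minus powr_add field_simps)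
  finally have val: "\<bar>poly (of_int_poly f) \<zeta>\<bar> \<le> real (Suc n) * D * real q powr (1 / real n - \<alpha> - 1)" .
  have "mahler_measure f \<le> real (Suc n) * real B" by (rule mahler_measure_le_height[OF f(2,3)])
  also have "\<dots> \<le> real (Suc n) * (D * real q powr (1 / real n))" using BD by (intro mult_left_mono) auto
  finally have "mahler_measure f powr w \<le> (real (Suc n) * (D * real q powr (1 / real n))) powr w"
    using assms(3) by (intro powr_mono2 mahler_measure_ge_0) auto
  also have "\<dots> = (real (Suc n) * D) powr w * real q powr (w / real n)"
    using \<open>D > 0\<close> by (simp add: powr_mult powr_powr)
  finally have "\<bar>poly (of_int_poly f) \<zeta>\<bar> * mahler_measure f powr w \<le>
     (real (Suc n) * D * real q powr (1 / real n - \<alpha> - 1)) * ((real (Suc n) * D) powr w * real q powr (w / real n))"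
    using val \<open>D > 0\<close> by (intro mult_mono) auto
  also have "\<dots> = E * (real q powr (1 / real n - \<alpha> - 1) * real q powr (w / real n))"
    by (simp add: E_def)
  also have "\<dots> = E * real q powr - \<kappa>"
    unfolding powr_add[symmetric] by (simp add: \<kappa>_def add_divide_distrib algebra_simps)
  also have "\<dots> < \<epsilon>" by (rule Q[OF \<open>q \<ge> Q\<close>])
  finally show ?thesis using f(1,2) by blast
qed

section \<open>Annihilating the solutions of the system\<close>

definition is_solution :: "nat \<Rightarrow> real \<Rightarrow> real \<Rightarrow> real \<Rightarrow> (nat \<Rightarrow> int) \<Rightarrow> bool" where
  "is_solution N \<zeta> \<eta> X v \<longleftrightarrow> (\<exists>i\<le>N. v i \<noteq> 0) \<and> \<bar>real_of_int (v 0)\<bar> \<le> X \<and>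
     (\<forall>i\<le>N. \<bar>\<zeta> ^ i * real_of_int (v 0) - real_of_int (v i)\<bar> \<le> X powr - \<eta>)"

text \<open>A vector \<open>v\<close> acts on polynomials of degree at most \<open>N\<close> as the linear form that sends \<open>T\<^sup>i\<close> to
  \<open>v i\<close>. Coefficients beyond \<open>N\<close> are cut off, which keeps the form linear on all polynomials.\<close>

definition pairing :: "nat \<Rightarrow> (nat \<Rightarrow> int) \<Rightarrow> real poly \<Rightarrow> real" where
  "pairing N v p = (\<Sum>i\<le>N. coeff p i * real_of_int (v i))"

lemma pairing_add: "pairing N v (p + q) = pairing N v p + pairing N v q"
  by (simp add: pairing_def sum.distrib algebra_simps)

lemma pairing_sum: "pairing N v (\<Sum>k\<in>A. p k) = (\<Sum>k\<in>A. pairing N v (p k))"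
proof -
  have "pairing N v 0 = 0" by (simp add: pairing_def)
  thus ?thesis
    by (induction A rule: infinite_finite_induct) (simp_all add: pairing_add)
qed

lemma pairing_monom_mult:
  assumes "degree p \<le> e" "k + e \<le> N"
  shows "pairing N v (monom c k * p) = c * (\<Sum>i\<le>e. coeff p i * real_of_int (v (i + k)))"
proof -
  have "pairing N v (monom c k * p) = (\<Sum>i\<in>{k..k + e}. c * coeff p (i - k) * real_of_int (v i))"
    unfolding pairing_def coeff_monom_mult
    using assms by (intro sum.mono_neutral_cong_right) (auto intro!: coeff_eq_0)
  also have "\<dots> = (\<Sum>i\<le>e. c * coeff p i * real_of_int (v (i + k)))"
    by (rule sum.reindex_bij_witness[of _ "\<lambda>i. i + k" "\<lambda>i. i - k"]) auto
  finally show ?thesis by (simp add: sum_distrib_left mult.assoc)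
qed

lemma pairing_multiple_eq_0:
  assumes "degree p \<le> e" "degree a \<le> m" "m + e \<le> N"
      and "\<And>k. k \<le> m \<Longrightarrow> (\<Sum>i\<le>e. coeff p i * real_of_int (v (i + k))) = 0"
  shows "pairing N v (a * p) = 0"
proof -
  have "a * p = (\<Sum>k\<le>degree a. monom (coeff a k) k * p)"
    by (subst (1) poly_as_sum_of_monoms[symmetric]) (rule sum_distrib_right)
  also have "pairing N v \<dots> = 0"
    unfolding pairing_sum using assms by (intro sum.neutral) (auto simp: pairing_monom_mult)
  finally show ?thesis .
qed

text \<open>The resultant carries coprimality from the integers to the reals.
  The qualified name refers to coprimality in the sense of common divisors being units.\<close>

lemma coprime_of_int_poly:
  fixes f g :: "int poly"
  assumes "prime_elem f" "\<not> f dvd g"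
  shows "Rings.coprime (of_int_poly f :: real poly) (of_int_poly g)"
proof -
  have "Rings.coprime f g"
    using assms by (rule prime_elem_imp_coprime)
  hence "resultant f g \<noteq> 0"
    by (simp add: resultant_0_gcd)
  hence "resultant (of_int_poly f :: real poly) (of_int_poly g) \<noteq> 0"
    by (simp add: of_int_hom.resultant_hom)
  hence "degree (gcd (of_int_poly f :: real poly) (of_int_poly g)) = 0"
    by (simp add: resultant_0_gcd)
  moreover have "gcd (of_int_poly f :: real poly) (of_int_poly g) \<noteq> 0"
    using assms(1) by auto
  ultimately show ?thesis
    by (metis coprime_iff_gcd_eq_1 is_unit_gcd is_unit_iff_degree)
qed

text \<open>The multiples of \<open>f\<close> and of \<open>g\<close> on which the form given by \<open>v\<close> vanishes add up to all
  polynomials of degree at most \<open>2 n\<close>: in a Bezout identity for \<open>T\<^sup>k\<close>, the cofactor of \<open>g\<close> can be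
  reduced modulo \<open>f\<close> to degree at most \<open>n - 1\<close>, and then the degree of the cofactor of \<open>f\<close> takes care of itself.
  This is where the dimension \<open>2 n\<close> is used: degrees \<open>n\<close> and \<open>n + 1\<close> are just small enough.\<close>

lemma common_annihilation_imp_zero:
  fixes f g :: "int poly" and v :: "nat \<Rightarrow> int"
  assumes "prime_elem f" "\<not> f dvd g" "1 \<le> degree f" "degree f \<le> n" "degree g \<le> Suc n"
      and f: "\<And>k. k + degree f \<le> 2 * n \<Longrightarrow> (\<Sum>i\<le>degree f. coeff f i * v (i + k)) = 0"
      and g: "\<And>k. k + Suc n \<le> 2 * n \<Longrightarrow> (\<Sum>i\<le>Suc n. coeff g i * v (i + k)) = 0"
      and "k \<le> 2 * n"
  shows "v k = 0"
proof -
  define F :: "real poly" where "F = of_int_poly f"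
  define G :: "real poly" where "G = of_int_poly g"
  have degF: "degree F = degree f" and degG: "degree G \<le> Suc n" and "F \<noteq> 0"
    using assms(1,5) by (auto simp: F_def G_def)
  have f': "(\<Sum>i\<le>degree f. coeff F i * real_of_int (v (i + k))) = 0" if "k + degree f \<le> 2 * n" for k
    using arg_cong[OF f[OF that], of real_of_int] by (simp add: F_def)
  have g': "(\<Sum>i\<le>Suc n. coeff G i * real_of_int (v (i + k))) = 0" if "k + Suc n \<le> 2 * n" for k
    using arg_cong[OF g[OF that], of real_of_int] by (simp add: G_def)
  obtain a b where ab: "a * F + b * G = 1"
    using coprime_of_int_poly[OF assms(1,2)] bezout_coefficients_fst_snd[of F G]
    by (auto simp: F_def G_def coprime_iff_gcd_eq_1)
  define T :: "real poly" where "T = monom 1 k"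
  define b' where "b' = (T * b) mod F"
  define a' where "a' = T * a + (T * b) div F * G"
  have "T = T * (a * F + b * G)" by (simp add: ab)
  also have "\<dots> = T * a * F + (T * b) * G" by (simp add: algebra_simps)
  also have "T * b = (T * b) div F * F + b'" by (simp add: b'_def)
  finally have T: "T = a' * F + b' * G" by (simp add: a'_def algebra_simps)
  have degb: "degree b' \<le> degree f - 1"
    using degree_mod_less[OF \<open>F \<noteq> 0\<close>, of "T * b"] by (auto simp: b'_def degF)
  have "degree (b' * G) \<le> degree b' + degree G" by (rule degree_mult_le)
  also have "\<dots> \<le> 2 * n" using degb degG assms(3,4) by linarith
  finally have "degree (T - b' * G) \<le> 2 * n"
    using assms(8) by (intro degree_diff_le) (auto simp: T_def degree_monom_eq)
  hence "degree (a' * F) \<le> 2 * n" by (simp add: T)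
  hence dega: "degree a' \<le> 2 * n - degree f"
    using \<open>F \<noteq> 0\<close> degF by (cases "a' = 0") (auto simp: degree_mult_eq)
  have "real_of_int (v k) = pairing (2 * n) v T"
  proof -
    have "pairing (2 * n) v T = pairing (2 * n) v (monom 1 k * 1)" by (simp add: T_def)
    also have "\<dots> = real_of_int (v k)"
      using assms(8) by (subst pairing_monom_mult[of 1 0]) auto
    finally show ?thesis ..
  qed
  also have "\<dots> = pairing (2 * n) v (a' * F) + pairing (2 * n) v (b' * G)"
    by (subst T) (rule pairing_add)
  also have "pairing (2 * n) v (a' * F) = 0"
    using assms(4) degF dega
    by (intro pairing_multiple_eq_0[where e = "degree f" and m = "2 * n - degree f"] f') auto
  also have "pairing (2 * n) v (b' * G) = 0"
    using assms(3,4) degG degb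
    by (intro pairing_multiple_eq_0[where e = "Suc n" and m = "n - 1"] g') auto
  finally show ?thesis by simp
qed

text \<open>The sum is an integer. It differs from \<open>\<zeta>\<^sup>k v\<^sub>0 p(\<zeta>)\<close> by at most \<open>(e + 1) H \<tau>\<close>, so it is zero as soon
  as both quantities are below one half.\<close>

lemma integer_combination_vanishes:
  fixes p :: "int poly" and v :: "nat \<Rightarrow> int"
  assumes "degree p \<le> e" "k + e \<le> N" "\<And>i. \<bar>real_of_int (coeff p i)\<bar> \<le> H"
      and "\<bar>real_of_int (v 0)\<bar> \<le> X" "\<And>i. i \<le> N \<Longrightarrow> \<bar>\<zeta> ^ i * real_of_int (v 0) - real_of_int (v i)\<bar> \<le> \<tau>"
      and "real (Suc e) * H * \<tau> < 1 / 2"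
      and "(1 + \<bar>\<zeta>\<bar>) ^ N * X * \<bar>poly (of_int_poly p) \<zeta>\<bar> < 1 / 2"
  shows "(\<Sum>i\<le>e. coeff p i * v (i + k)) = 0"
proof -
  have H: "H \<ge> 0" using assms(3)[of 0] by linarith
  have X: "X \<ge> 0" using assms(4) by linarith
  let ?E = "\<lambda>i. \<zeta> ^ (i + k) * real_of_int (v 0) - real_of_int (v (i + k))"
  have "real_of_int (\<Sum>i\<le>e. coeff p i * v (i + k)) =
        \<zeta> ^ k * real_of_int (v 0) * poly (of_int_poly p) \<zeta> - (\<Sum>i\<le>e. real_of_int (coeff p i) * ?E i)"
    unfolding poly_of_int_poly_eq_sum[OF assms(1)]
    by (simp add: sum_distrib_left sum_subtractf algebra_simps power_add)
  also have "\<bar>\<dots>\<bar> \<le> \<bar>\<zeta> ^ k * real_of_int (v 0) * poly (of_int_poly p) \<zeta>\<bar> + \<bar>\<Sum>i\<le>e. real_of_int (coeff p i) * ?E i\<bar>"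
    by (rule abs_triangle_ineq4)
  also have "\<bar>\<Sum>i\<le>e. real_of_int (coeff p i) * ?E i\<bar> \<le> (\<Sum>i\<le>e. H * \<tau>)"
    using assms(2,3,5) H by (intro order_trans[OF sum_abs] sum_mono) (auto simp: abs_mult intro!: mult_mono)
  also have "(\<Sum>i\<le>e. H * \<tau>) = real (Suc e) * H * \<tau>" by simp
  also have "\<bar>\<zeta> ^ k * real_of_int (v 0) * poly (of_int_poly p) \<zeta>\<bar> \<le> (1 + \<bar>\<zeta>\<bar>) ^ N * X * \<bar>poly (of_int_poly p) \<zeta>\<bar>"
  proof -
    have "\<bar>\<zeta>\<bar> ^ k \<le> (1 + \<bar>\<zeta>\<bar>) ^ k" by (intro power_mono) auto
    also have "\<dots> \<le> (1 + \<bar>\<zeta>\<bar>) ^ N" using assms(2) by (intro power_increasing) auto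
    finally show ?thesis
      using assms(4) X by (auto simp: abs_mult power_abs intro!: mult_mono)
  qed
  finally have "\<bar>real_of_int (\<Sum>i\<le>e. coeff p i * v (i + k))\<bar> < 1"
    using assms(6,7) by linarith
  thus ?thesis by linarith
qed

text \<open>Take a prime \<open>f\<close> of degree at most \<open>n\<close> with large Mahler measure \<open>M\<close> and \<open>\<bar>f(\<zeta>)\<bar> < M\<^sup>-\<^sup>w\<close>, and by the box
  principle a polynomial \<open>g\<close> of degree at most \<open>n + 1\<close>, whose height is a fraction of
  \<open>M\<close>, too small for a multiple of \<open>f\<close>, with \<open>\<bar>g(\<zeta>)\<bar>\<close> at most of order \<open>M powr (- (n + 1))\<close>.
  Choose \<open>X\<close> of order \<open>M powr (1 / \<eta>)\<close>, so that the errors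
  \<open>X powr (- \<eta>)\<close> of a solution \<open>v\<close> compensate the heights of \<open>f\<close> and \<open>g\<close>. The values \<open>X \<bar>f(\<zeta>)\<bar>\<close> and
  \<open>X \<bar>g(\<zeta>)\<bar>\<close> are small because \<open>1 / \<eta> < w\<close> and \<open>1 / \<eta> < n + 1\<close>. Hence \<open>v\<close> is annihilated by \<open>f\<close>, \<open>g\<close> and
  their shifts, and \<open>v = 0\<close>.\<close>

lemma contradiction_from_small_polynomials:
  fixes \<zeta> \<eta> w :: real
  assumes "\<not> algebraic \<zeta>" "n \<ge> 1" "\<eta> > 1 / real (Suc n)" "w > 1 / \<eta>"
      and unif: "\<forall>\<^sub>F X :: real in at_top. \<exists>v. is_solution (2 * n) \<zeta> \<eta> X v"
      and small: "\<And>\<epsilon>. \<epsilon> > 0 \<Longrightarrow> \<exists>f :: int poly. f \<noteq> 0 \<and> degree f \<le> n \<and>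
             \<bar>poly (of_int_poly f) \<zeta>\<bar> * mahler_measure f powr w < \<epsilon>"
  shows False
proof -
  have "1 / real (Suc n) > 0" by simp
  hence "\<eta> > 0" using assms(3) by linarith
  have "1 / \<eta> < real (Suc n)"
    using assms(3) \<open>\<eta> > 0\<close> by (simp add: field_simps del: of_nat_Suc)
  have "1 / \<eta> > 0" using \<open>\<eta> > 0\<close> by simp
  hence "w > 0" using assms(4) by linarith
  define Z where "Z = (1 + \<bar>\<zeta>\<bar>) ^ (2 * n)"
  have Z: "Z > 0" by (simp add: Z_def add_pos_nonneg)
  \<comment> \<open>chosen so that the contribution of the errors of the solution is at most one quarter for \<open>f\<close> and \<open>g\<close>\<close>
  define K where "K = 4 * real (n + 2) * 2 ^ n"
  have K: "K > 0" by (simp add: K_def)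
  define E where "E = Z * K powr (1 / \<eta>)"
  define E' where "E' = E * (4 * real (n + 2) * Z) * (2 * real (n + 3)) ^ Suc n"
  have tend: "((\<lambda>M. c * M powr - e) \<longlongrightarrow> 0) at_top" if "e > 0" for c e :: real
  proof -
    have "((\<lambda>M. c * M powr - e) \<longlongrightarrow> c * 0) at_top"
      using that by (intro tendsto_mult tendsto_const tendsto_neg_powr filterlim_ident) auto
    thus ?thesis by simp
  qed
  have "\<forall>\<^sub>F M in at_top. E * M powr - (w - 1 / \<eta>) < 1 / 2"
    using assms(4) by (intro order_tendstoD(2)[OF tend]) auto
  moreover have "\<forall>\<^sub>F M in at_top. E' * M powr - (real (Suc n) - 1 / \<eta>) < 1 / 2"
    using \<open>1 / \<eta> < real (Suc n)\<close> by (intro order_tendstoD(2)[OF tend]) auto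
  moreover have "\<forall>\<^sub>F M in at_top. \<exists>v. is_solution (2 * n) \<zeta> \<eta> ((K * M) powr (1 / \<eta>)) v"
  proof (rule eventually_compose_filterlim[of "\<lambda>X. \<exists>v. is_solution (2 * n) \<zeta> \<eta> X v" at_top])
    show "\<forall>\<^sub>F X in at_top. \<exists>v. is_solution (2 * n) \<zeta> \<eta> X v" by (rule unif)
    show "filterlim (\<lambda>M. (K * M) powr (1 / \<eta>)) at_top at_top"
      using K \<open>1 / \<eta> > 0\<close> by real_asymp
  qed
  moreover have "\<forall>\<^sub>F M in at_top. 2 * real (n + 3) \<le> M"
    by (rule eventually_ge_at_top)
  ultimately have "\<forall>\<^sub>F M in at_top. E * M powr - (w - 1 / \<eta>) < 1 / 2 \<and>
     E' * M powr - (real (Suc n) - 1 / \<eta>) < 1 / 2 \<and> (\<exists>v. is_solution (2 * n) \<zeta> \<eta> ((K * M) powr (1 / \<eta>)) v) \<and> 2 * real (n + 3) \<le> M"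
    by eventually_elim blast
  then obtain M0 where M0: "\<And>M. M \<ge> M0 \<Longrightarrow> E * M powr - (w - 1 / \<eta>) < 1 / 2 \<and>
     E' * M powr - (real (Suc n) - 1 / \<eta>) < 1 / 2 \<and> (\<exists>v. is_solution (2 * n) \<zeta> \<eta> ((K * M) powr (1 / \<eta>)) v) \<and> 2 * real (n + 3) \<le> M"
    unfolding eventually_at_top_linorder by blast
  obtain \<epsilon> where \<epsilon>: "\<epsilon> > 0"
    "\<And>f :: int poly. f \<noteq> 0 \<Longrightarrow> degree f \<le> n \<Longrightarrow> mahler_measure f \<le> M0 \<Longrightarrow> \<epsilon> \<le> \<bar>poly (of_int_poly f) \<zeta>\<bar>"
    using value_bounded_below[OF assms(1), of n M0] by blast
  define \<delta> where "\<delta> = min \<epsilon> (1 / 2)"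
  have \<delta>: "0 < \<delta>" "\<delta> < 1" "\<delta> \<le> \<epsilon>" using \<epsilon>(1) by (auto simp: \<delta>_def)
  obtain f0 :: "int poly" where f0: "f0 \<noteq> 0" "degree f0 \<le> n"
    "\<bar>poly (of_int_poly f0) \<zeta>\<bar> * mahler_measure f0 powr w < \<delta> ^ n"
    using small[of "\<delta> ^ n"] \<delta>(1) by auto
  have "\<delta> ^ n \<le> \<delta> ^ degree f0"
    using f0(2) \<delta> by (intro power_decreasing) auto
  with f0(3) have "\<bar>poly (of_int_poly f0) \<zeta>\<bar> * mahler_measure f0 powr w < \<delta> ^ degree f0" by linarith
  then obtain f :: "int poly" where f: "prime_elem f" "f dvd f0" "degree f \<ge> 1"
    "\<bar>poly (of_int_poly f) \<zeta>\<bar> * mahler_measure f powr w < \<delta>"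
    using prime_factor_small[OF f0(1) _ \<delta>(1,2), of w \<zeta>] \<open>w > 0\<close> by (metis less_imp_le)
  have degf: "degree f \<le> n"
    using dvd_imp_degree_le[OF f(2) f0(1)] f0(2) by linarith
  define M where "M = mahler_measure f"
  have "M \<ge> 1"
    unfolding M_def using f(1) by (intro mahler_measure_poly_ge_1) auto
  have "M > M0"
  proof (rule ccontr)
    assume "\<not> M > M0"
    hence "\<epsilon> \<le> \<bar>poly (of_int_poly f) \<zeta>\<bar>"
      using f(1) degf by (intro \<epsilon>(2)) (auto simp: M_def)
    also have "\<dots> * 1 \<le> \<bar>poly (of_int_poly f) \<zeta>\<bar> * M powr w"
      using \<open>M \<ge> 1\<close> \<open>w > 0\<close> by (intro mult_left_mono) (auto intro: ge_one_powr_ge_zero)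
    finally show False using f(4) \<delta>(3) by (simp add: M_def)
  qed
  define X where "X = (K * M) powr (1 / \<eta>)"
  from M0[of M] \<open>M > M0\<close> obtain v where M: "E * M powr - (w - 1 / \<eta>) < 1 / 2"
     "E' * M powr - (real (Suc n) - 1 / \<eta>) < 1 / 2" "is_solution (2 * n) \<zeta> \<eta> X v" "2 * real (n + 3) \<le> M"
    unfolding X_def by auto
  have X: "X powr - \<eta> = 1 / (K * M)"
    using K \<open>M \<ge> 1\<close> \<open>\<eta> > 0\<close> unfolding X_def powr_powr by (simp add: powr_minus field_simps)
  have ZX: "Z * X = E * M powr (1 / \<eta>)"
    using K \<open>M \<ge> 1\<close> by (simp add: E_def X_def powr_mult)
  have "X > 0" using K \<open>M \<ge> 1\<close> by (simp add: X_def)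
  \<comment> \<open>the height of \<open>g\<close>; the Mahler measure of \<open>g\<close> is then at most \<open>(n + 2) B < M\<close>\<close>
  define B where "B = nat \<lfloor>M / real (n + 3)\<rfloor>"
  have quot: "2 \<le> M / real (n + 3)"
    using M(4) by (simp add: field_simps)
  hence B: "real B \<le> M / real (n + 3)" "M / real (n + 3) < real B + 1"
    unfolding B_def by linarith+
  have "real B > 1" using B(2) quot by linarith
  hence "B \<ge> 1" by simp
  have half: "u / 2 \<le> real B" if "u < real B + 1" for u
    using that \<open>real B > 1\<close> by linarith
  have B': "M / (2 * real (n + 3)) \<le> real B"
    using half[OF B(2)] by (simp add: mult.commute)
  have theta: "\<bar>\<zeta> ^ i\<bar> \<le> Z" if "i \<le> Suc n" for i
  proof -
    have "\<bar>\<zeta> ^ i\<bar> \<le> (1 + \<bar>\<zeta>\<bar>) ^ i" unfolding power_abs by (intro power_mono) auto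
    also have "\<dots> \<le> Z" unfolding Z_def using that assms(2) by (intro power_increasing) auto
    finally show ?thesis .
  qed
  obtain g :: "int poly" where g: "g \<noteq> 0" "degree g \<le> Suc n" "\<And>i. \<bar>coeff g i\<bar> \<le> int B"
    "\<bar>\<Sum>i\<le>Suc n. real_of_int (coeff g i) * \<zeta> ^ i\<bar> < 4 * real (Suc (Suc n)) * Z / real B ^ Suc n"
    using small_integer_combination[of "Suc n" "\<lambda>i. \<zeta> ^ i", OF theta Z _ \<open>B \<ge> 1\<close>] by auto
  have "\<not> f dvd g"
  proof
    assume "f dvd g"
    hence "M \<le> mahler_measure g" unfolding M_def by (rule mahler_measure_dvd[OF g(1)])
    also have "\<dots> \<le> real (Suc (Suc n)) * real B" by (rule mahler_measure_le_height[OF g(2,3)])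
    also have "\<dots> \<le> real (Suc (Suc n)) * (M / real (n + 3))"
      using B(1) by (intro mult_left_mono) auto
    also have "\<dots> < M" using \<open>M \<ge> 1\<close> by (simp add: field_simps)
    finally show False by simp
  qed
  have v: "\<exists>i\<le>2 * n. v i \<noteq> 0" "\<bar>real_of_int (v 0)\<bar> \<le> X"
    "\<And>i. i \<le> 2 * n \<Longrightarrow> \<bar>\<zeta> ^ i * real_of_int (v 0) - real_of_int (v i)\<bar> \<le> 1 / (K * M)"
    using M(3) by (auto simp: is_solution_def X)
  have fkill: "(\<Sum>i\<le>degree f. coeff f i * v (i + k)) = 0" if "k + degree f \<le> 2 * n" for k
  proof (rule integer_combination_vanishes[OF order_refl that _ v(2,3)])
    show "\<bar>real_of_int (coeff f i)\<bar> \<le> 2 ^ n * M" for i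
      unfolding M_def by (rule coeff_le_mahler_measure[OF degf])
    have "real (Suc (degree f)) * (2 ^ n * M) * (1 / (K * M)) = real (Suc (degree f)) / (4 * real (n + 2))"
      using \<open>M \<ge> 1\<close> by (simp add: K_def)
    also have "\<dots> < 1 / 2" using degf by (simp add: field_simps)
    finally show "real (Suc (degree f)) * (2 ^ n * M) * (1 / (K * M)) < 1 / 2" .
    have "\<bar>poly (of_int_poly f) \<zeta>\<bar> * M powr w < 1"
      using f(4) \<delta>(2) by (simp add: M_def)
    hence "\<bar>poly (of_int_poly f) \<zeta>\<bar> \<le> M powr - w"
      using \<open>M \<ge> 1\<close> by (simp add: powr_minus field_simps)
    hence "Z * X * \<bar>poly (of_int_poly f) \<zeta>\<bar> \<le> Z * X * M powr - w"
      using Z \<open>X > 0\<close> by (intro mult_left_mono) auto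
    also have "\<dots> = E * M powr - (w - 1 / \<eta>)"
      unfolding ZX by (simp add: mult.assoc flip: powr_add)
    finally show "(1 + \<bar>\<zeta>\<bar>) ^ (2 * n) * X * \<bar>poly (of_int_poly f) \<zeta>\<bar> < 1 / 2"
      using M(1) by (simp add: Z_def)
  qed
  have gkill: "(\<Sum>i\<le>Suc n. coeff g i * v (i + k)) = 0" if "k + Suc n \<le> 2 * n" for k
  proof (rule integer_combination_vanishes[OF g(2) that _ v(2,3)])
    show "\<bar>real_of_int (coeff g i)\<bar> \<le> real B" for i
      using g(3)[of i] by linarith
    have KM: "K * M = real (n + 2) * M * (4 * 2 ^ n)"
      by (simp only: K_def mult_ac)
    have "real (Suc (Suc n)) * real B * (1 / (K * M)) \<le> real (Suc (Suc n)) * M * (1 / (K * M))"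
      using B(1) \<open>M \<ge> 1\<close> K by (intro mult_right_mono mult_left_mono order_trans[OF B(1)]) (auto simp: field_simps)
    also have "\<dots> = (real (n + 2) * M) * 1 / (real (n + 2) * M * (4 * 2 ^ n))"
      unfolding KM times_divide_eq_right by simp
    also have "\<dots> = 1 / (4 * 2 ^ n)"
      using \<open>M \<ge> 1\<close> by (intro nonzero_mult_divide_mult_cancel_left) (simp del: of_nat_add)
    also have "\<dots> \<le> 1 / (4 * 1)" by (intro divide_left_mono) auto
    finally have "real (Suc (Suc n)) * real B * (1 / (K * M)) \<le> 1 / 4" by simp
    thus "real (Suc (Suc n)) * real B * (1 / (K * M)) < 1 / 2" by linarith
    have "\<bar>poly (of_int_poly g) \<zeta>\<bar> \<le> 4 * real (n + 2) * Z / real B ^ Suc n"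
      using g(4) by (simp add: poly_of_int_poly_eq_sum[OF g(2)])
    also have "\<dots> \<le> 4 * real (n + 2) * Z / (M / (2 * real (n + 3))) ^ Suc n"
    proof (rule divide_left_mono)
      have pos: "0 < M / (2 * real (n + 3))" using \<open>M \<ge> 1\<close> by simp
      thus "(M / (2 * real (n + 3))) ^ Suc n \<le> real B ^ Suc n"
        using B' by (intro power_mono) auto
      show "0 \<le> 4 * real (n + 2) * Z" using Z by simp
      show "0 < real B ^ Suc n * (M / (2 * real (n + 3))) ^ Suc n"
        using pos \<open>B \<ge> 1\<close> by (intro mult_pos_pos zero_less_power) auto
    qed
    also have "\<dots> = 4 * real (n + 2) * Z * (2 * real (n + 3)) ^ Suc n * inverse (M ^ Suc n)"
    proof -
      have "a / (m / c) ^ k = a * c ^ k * inverse (m ^ k)" for a m c :: real and k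
        unfolding power_divide by (simp add: field_simps)
      thus ?thesis .
    qed
    also have "inverse (M ^ Suc n) = M powr - real (Suc n)"
      using \<open>M \<ge> 1\<close> by (simp only: powr_minus powr_realpow)
    finally have "Z * X * \<bar>poly (of_int_poly g) \<zeta>\<bar> \<le> Z * X * (4 * real (n + 2) * Z * (2 * real (n + 3)) ^ Suc n * M powr - real (Suc n))"
      using Z \<open>X > 0\<close> by (intro mult_left_mono) auto
    also have "\<dots> = E' * (M powr (1 / \<eta>) * M powr - real (Suc n))"
      unfolding ZX E'_def by (simp only: mult_ac)
    also have "\<dots> = E' * M powr - (real (Suc n) - 1 / \<eta>)"
      unfolding powr_add[symmetric] by (simp add: algebra_simps)
    finally show "(1 + \<bar>\<zeta>\<bar>) ^ (2 * n) * X * \<bar>poly (of_int_poly g) \<zeta>\<bar> < 1 / 2"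
      using M(2) by (simp add: Z_def)
  qed
  have "v k = 0" if "k \<le> 2 * n" for k
    by (rule common_annihilation_imp_zero[OF f(1) \<open>\<not> f dvd g\<close> f(3) degf g(2) fkill gkill that])
  with v(1) show False by blast
qed

section \<open>The cubic polynomial\<close>

lemma poly_P:
  "poly (P n) t = t ^ 3 + (real n - 1) / real n * t\<^sup>2 + (2 * real n - 1) * t - (2 * real n - 1) / real n"
proof -
  have "(- 2 * real n + 1) / real n = - ((2 * real n - 1) / real n)"
    by (simp add: minus_divide_left)
  thus ?thesis by (simp add: P_def power3_eq_cube power2_eq_square algebra_simps)
qed

lemma poly_P_strict_mono:
  assumes "n \<ge> 1" "0 \<le> s" "s < t"
  shows "poly (P n) s < poly (P n) t"
proof -
  have "s ^ 3 \<le> t ^ 3" "s\<^sup>2 \<le> t\<^sup>2"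
    using assms by (auto intro: power_mono)
  moreover have "(2 * real n - 1) * s < (2 * real n - 1) * t"
    using assms by (intro mult_strict_left_mono) auto
  moreover have "(real n - 1) / real n * s\<^sup>2 \<le> (real n - 1) / real n * t\<^sup>2"
    using assms \<open>s\<^sup>2 \<le> t\<^sup>2\<close> by (intro mult_left_mono) auto
  ultimately show ?thesis unfolding poly_P by linarith
qed

lemma poly_P_unique_root:
  assumes "n \<ge> 1"
  shows "\<exists>!\<theta>. \<theta> \<in> {0<..<1 / real n} \<and> poly (P n) \<theta> = 0"
proof -
  have "poly (P n) 0 < 0"
    using assms by (simp add: poly_P)
  moreover have "poly (P n) (1 / real n) > 0"
  proof -
    have "poly (P n) (1 / real n) = (1 / real n) ^ 3 + (real n - 1) / real n * (1 / real n)\<^sup>2"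
      unfolding poly_P by simp
    also have "\<dots> > 0"
      using assms by (intro add_pos_nonneg) auto
    finally show ?thesis .
  qed
  ultimately obtain \<theta> where \<theta>: "0 < \<theta>" "\<theta> < 1 / real n" "poly (P n) \<theta> = 0"
    using poly_IVT_pos[of 0 "1 / real n" "P n"] assms by auto
  show ?thesis
  proof (rule ex1I[of _ \<theta>])
    fix t assume t: "t \<in> {0<..<1 / real n} \<and> poly (P n) t = 0"
    show "t = \<theta>"
      using poly_P_strict_mono[OF assms, of t \<theta>] poly_P_strict_mono[OF assms, of \<theta> t] t \<theta>
      by (cases t \<theta> rule: linorder_cases) auto
  qed (use \<theta> in auto)
qed

text \<open>At \<open>t = 1 / (n + 1)\<close> the terms of degree \<open>1\<close> and \<open>0\<close> add up to at most \<open>- t\<close>, which outweighs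
  \<open>t\<^sup>3 + t\<^sup>2\<close>. The bound makes polynomials of degree \<open>n + 1\<close> usable for exponents above the root.\<close>

lemma poly_P_root_gt:
  assumes "n \<ge> 1" "poly (P n) \<theta> = 0" "0 < \<theta>"
  shows "1 / real (Suc n) < \<theta>"
proof (rule ccontr)
  assume "\<not> ?thesis"
  hence le: "\<theta> \<le> 1 / real (Suc n)" by simp
  define t where "t = 1 / real (Suc n)"
  have t: "0 < t" "t \<le> 1 / 2" using assms(1) by (auto simp: t_def)
  have "(real n - 1) / real n * t\<^sup>2 \<le> 1 * t\<^sup>2"
    using assms(1) by (intro mult_right_mono) auto
  moreover have "(2 * real n - 1) * t - (2 * real n - 1) / real n = - ((2 * real n - 1) / real n) * t"
    using assms(1) by (simp add: t_def divide_simps) (simp add: algebra_simps)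
  moreover have "1 * t \<le> (2 * real n - 1) / real n * t"
    using assms(1) t by (intro mult_right_mono) (auto simp: field_simps)
  moreover have "t * (t\<^sup>2 + t) < t * 1"
  proof (intro mult_strict_left_mono t)
    have "t\<^sup>2 \<le> (1 / 2)\<^sup>2" using t by (intro power_mono) auto
    thus "t\<^sup>2 + t < 1" using t by (simp add: power2_eq_square)
  qed
  ultimately have "poly (P n) t < 0"
    unfolding poly_P by (simp add: power3_eq_cube power2_eq_square algebra_simps)
  moreover have "poly (P n) \<theta> \<le> poly (P n) t"
    using poly_P_strict_mono[OF assms(1), of \<theta> t] le assms(3) by (cases "\<theta> = t") (auto simp: t_def)
  ultimately show False using assms(2) by simp
qed

text \<open>Positivity of the cubic is exactly the condition under which the exponents can be
  chosen: with \<open>\<delta>\<^sub>0 = (1 - \<eta>) / (2 n - 1)\<close> and \<open>\<delta>\<^sub>1\<close> the solution of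
  \<open>1 / \<eta> = n - 1 + n \<eta> (1 - \<delta>\<^sub>1) / (1 - \<eta>)\<close>, the difference \<open>\<delta>\<^sub>1 - \<delta>\<^sub>0\<close> is a positive multiple of
  the value of the cubic at \<open>\<eta>\<close>.\<close>

lemma poly_P_pos_imp_exponents:
  assumes "n \<ge> 1" "0 < \<eta>" "\<eta> < 1 / real n" "poly (P n) \<eta> > 0"
  obtains \<delta> w where "1 - \<eta> < real (2 * n - 1) * \<delta>" "\<delta> < 1"
    "1 / \<eta> < w" "w < real n - 1 + real n * (\<eta> * (1 - \<delta>) / (1 - \<eta>))"
proof -
  have n: "real n \<ge> 1" using assms(1) by simp
  have "1 / real n \<le> 1" using n by simp
  hence "\<eta> < 1" using assms(3) by linarith
  define N where "N = 2 * real n - 1"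
  have N: "real (2 * n - 1) = N" "N \<ge> 1" using assms(1) by (auto simp: N_def of_nat_diff)
  define \<delta>\<^sub>0 where "\<delta>\<^sub>0 = (1 - \<eta>) / N"
  define \<delta>\<^sub>1 where "\<delta>\<^sub>1 = 1 - (1 / \<eta> - real n + 1) * (1 - \<eta>) / (real n * \<eta>)"
  have "1 / \<eta> > real n"
    using assms n by (simp add: field_simps)
  hence "(1 / \<eta> - real n + 1) * (1 - \<eta>) / (real n * \<eta>) > 0"
    using assms n \<open>\<eta> < 1\<close> by (intro divide_pos_pos mult_pos_pos) auto
  hence "\<delta>\<^sub>1 < 1" by (simp add: \<delta>\<^sub>1_def)
  have "\<delta>\<^sub>0 < \<delta>\<^sub>1"
  proof -
    have "0 < real n * poly (P n) \<eta>" using assms n by simp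
    also have "\<dots> = real n * \<eta> ^ 3 + (real n - 1) * \<eta>\<^sup>2 + real n * N * \<eta> - N"
      using n by (simp add: poly_P N_def field_simps)
    also have "\<dots> = (\<delta>\<^sub>1 - \<delta>\<^sub>0) * (N * (real n * \<eta>\<^sup>2))"
    proof -
      have 1: "\<delta>\<^sub>1 * (real n * \<eta>\<^sup>2) = real n * \<eta>\<^sup>2 - (1 - real n * \<eta> + \<eta>) * (1 - \<eta>)"
        using assms n by (simp add: \<delta>\<^sub>1_def field_simps power2_eq_square)
      have 2: "\<delta>\<^sub>0 * N = 1 - \<eta>" using N by (simp add: \<delta>\<^sub>0_def)
      have "(\<delta>\<^sub>1 - \<delta>\<^sub>0) * (N * (real n * \<eta>\<^sup>2)) = N * (\<delta>\<^sub>1 * (real n * \<eta>\<^sup>2)) - (\<delta>\<^sub>0 * N) * (real n * \<eta>\<^sup>2)"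
        by (simp add: algebra_simps)
      also have "\<dots> = N * (real n * \<eta>\<^sup>2 - (1 - real n * \<eta> + \<eta>) * (1 - \<eta>)) - (1 - \<eta>) * (real n * \<eta>\<^sup>2)"
        by (simp only: 1 2)
      also have "\<dots> = real n * \<eta> ^ 3 + (real n - 1) * \<eta>\<^sup>2 + real n * N * \<eta> - N"
        by (simp add: N_def algebra_simps power2_eq_square power3_eq_cube)
      finally show ?thesis ..
    qed
    finally have "0 < (\<delta>\<^sub>1 - \<delta>\<^sub>0) * (N * (real n * \<eta>\<^sup>2))" .
    moreover have "0 < N * (real n * \<eta>\<^sup>2)" using assms n N by simp
    ultimately have "0 < \<delta>\<^sub>1 - \<delta>\<^sub>0" by (rule zero_less_mult_pos2)
    thus ?thesis by simp
  qed
  define \<delta> where "\<delta> = (\<delta>\<^sub>0 + \<delta>\<^sub>1) / 2"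
  have \<delta>: "\<delta>\<^sub>0 < \<delta>" "\<delta> < \<delta>\<^sub>1" "\<delta> < 1" using \<open>\<delta>\<^sub>0 < \<delta>\<^sub>1\<close> \<open>\<delta>\<^sub>1 < 1\<close> by (auto simp: \<delta>_def)
  have "1 - \<eta> < N * \<delta>"
    using \<delta>(1) N by (simp add: \<delta>\<^sub>0_def field_simps)
  moreover have "1 / \<eta> < real n - 1 + real n * (\<eta> * (1 - \<delta>) / (1 - \<eta>))"
  proof -
    have "1 / \<eta> = real n - 1 + real n * (\<eta> * (1 - \<delta>\<^sub>1) / (1 - \<eta>))"
      using assms n \<open>\<eta> < 1\<close> by (simp add: \<delta>\<^sub>1_def)
    also have "\<dots> < real n - 1 + real n * (\<eta> * (1 - \<delta>) / (1 - \<eta>))"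
      using assms n \<delta> \<open>\<eta> < 1\<close> by (simp add: divide_strict_right_mono)
    finally show ?thesis .
  qed
  then obtain w where "1 / \<eta> < w" "w < real n - 1 + real n * (\<eta> * (1 - \<delta>) / (1 - \<eta>))"
    using dense by blast
  ultimately show ?thesis using \<delta>(3) N(1) that by metis
qed

section \<open>The bound for the uniform exponent\<close>

lemma uniform_exponent_solutions:
  assumes "uniform_exponent N \<zeta> \<eta>\<^sub>0" "\<eta> \<le> \<eta>\<^sub>0"
  shows "\<forall>\<^sub>F X :: real in at_top. \<exists>v. is_solution N \<zeta> \<eta> X v"
  using assms(1)[unfolded uniform_exponent_def] eventually_ge_at_top[of 1]
proof eventually_elim
  case (elim X)
  then obtain x y where xy: "x \<noteq> 0 \<or> (\<exists>i\<in>{1..N}. y i \<noteq> 0)" "\<bar>real_of_int x\<bar> \<le> X"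
    "(MAX i\<in>{1..N}. \<bar>\<zeta> ^ i * of_int x - of_int (y i)\<bar>) \<le> X powr - \<eta>\<^sub>0" by blast
  define v where "v = y(0 := x)"
  have "X powr - \<eta>\<^sub>0 \<le> X powr - \<eta>"
    using elim(2) assms(2) by (intro powr_mono) auto
  have "\<bar>\<zeta> ^ i * real_of_int (v 0) - real_of_int (v i)\<bar> \<le> X powr - \<eta>" if "i \<le> N" for i
  proof (cases "i = 0")
    case False
    hence "\<bar>\<zeta> ^ i * of_int x - of_int (y i)\<bar> \<le> (MAX i\<in>{1..N}. \<bar>\<zeta> ^ i * of_int x - of_int (y i)\<bar>)"
      using that by (intro Max_ge) auto
    thus ?thesis using xy(3) \<open>X powr - \<eta>\<^sub>0 \<le> X powr - \<eta>\<close> False by (simp add: v_def)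
  qed simp
  moreover have "\<exists>i\<le>N. v i \<noteq> 0"
    using xy(1)
  proof
    assume "x \<noteq> 0"
    thus ?thesis by (intro exI[of _ 0]) (simp add: v_def)
  next
    assume "\<exists>i\<in>{1..N}. y i \<noteq> 0"
    then obtain i where "i \<in> {1..N}" "y i \<noteq> 0" by blast
    thus ?thesis by (intro exI[of _ i]) (simp add: v_def)
  qed
  moreover have "\<bar>real_of_int (v 0)\<bar> \<le> X" using xy(2) by (simp add: v_def)
  ultimately show ?case unfolding is_solution_def by blast
qed

text \<open>In a solution \<open>v\<close> with \<open>X > 1\<close> the first coordinate cannot vanish, because the others
  would then be integers of absolute value below \<open>1\<close>. So \<open>\<bar>v 0\<bar>\<close> competes with the best denominator.\<close>

lemma best_approx_error_le:
  assumes "N \<ge> 1" "\<eta> > 0"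
      and "\<forall>\<^sub>F X :: real in at_top. \<exists>v. is_solution N \<zeta> \<eta> X v"
  shows "\<forall>\<^sub>F t in sequentially. approx_error N \<zeta> (best_approx N \<zeta> t) \<le> real t powr - \<eta>"
  using eventually_compose_filterlim[OF assms(3) filterlim_real_sequentially] eventually_gt_at_top[of 1]
proof eventually_elim
  case (elim t)
  then obtain v where v: "\<exists>i\<le>N. v i \<noteq> 0" "\<bar>real_of_int (v 0)\<bar> \<le> real t"
    "\<And>i. i \<le> N \<Longrightarrow> \<bar>\<zeta> ^ i * real_of_int (v 0) - real_of_int (v i)\<bar> \<le> real t powr - \<eta>" unfolding is_solution_def by blast
  have "real t powr - \<eta> < 1"
    using elim(2) assms(2) by (simp add: powr_minus inverse_less_1_iff)
  have "v 0 \<noteq> 0"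
  proof
    assume "v 0 = 0"
    obtain i where i: "i \<le> N" "v i \<noteq> 0" using v(1) by blast
    have "\<bar>real_of_int (v i)\<bar> < 1"
      using v(3)[OF i(1)] \<open>v 0 = 0\<close> \<open>real t powr - \<eta> < 1\<close> by simp
    with i(2) show False by linarith
  qed
  define q where "q = nat \<bar>v 0\<bar>"
  have q: "1 \<le> q" "q \<le> t" "real q = \<bar>real_of_int (v 0)\<bar>"
    using \<open>v 0 \<noteq> 0\<close> v(2) by (auto simp: q_def)
  have "\<bar>\<zeta> ^ i * real q - real_of_int (approx_point \<zeta> q i)\<bar> \<le> real t powr - \<eta>" if "i \<le> N" for i
  proof -
    have "\<bar>\<zeta> ^ i * real q - real_of_int (approx_point \<zeta> q i)\<bar> \<le> \<bar>\<zeta> ^ i * real q - real_of_int (sgn (v 0) * v i)\<bar>"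
      unfolding approx_point_def by (rule round_diff_minimal)
    also have "\<dots> = \<bar>\<zeta> ^ i * real_of_int (v 0) - real_of_int (v i)\<bar>"
      unfolding q(3) by (cases "v 0 > 0") (use \<open>v 0 \<noteq> 0\<close> in \<open>auto simp: abs_if\<close>)
    also have "\<dots> \<le> real t powr - \<eta>" by (rule v(3)[OF that])
    finally show ?thesis .
  qed
  hence "approx_error N \<zeta> q \<le> real t powr - \<eta>"
    unfolding approx_error_def using assms(1) by (subst Max_le_iff) auto
  thus ?case
    using best_approx_minimal[of t q N \<zeta>] q by linarith
qed

text \<open>An exponent above the root can be lowered to some \<open>\<eta>\<close> between the root and \<open>1 / n\<close>, where
  the cubic is positive, and then the three estimates contradict each other.\<close>

lemma uniform_exponent_le_root:
  assumes "n \<ge> 1" "0 < \<theta>" "\<theta> < 1 / real n" "poly (P n) \<theta> = 0" "\<not> algebraic \<zeta>"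
      and "uniform_exponent (2 * n) \<zeta> \<eta>\<^sub>0"
  shows "\<eta>\<^sub>0 \<le> \<theta>"
proof (rule ccontr)
  assume "\<not> \<eta>\<^sub>0 \<le> \<theta>"
  then obtain \<eta> where \<eta>: "\<theta> < \<eta>" "\<eta> \<le> \<eta>\<^sub>0" "\<eta> < 1 / real n"
    using assms(3) dense[of \<theta> "min \<eta>\<^sub>0 (1 / real n)"] by auto
  have "1 / real n \<le> 1" using assms(1) by simp
  hence "0 < \<eta>" "\<eta> < 1" using \<eta> assms(2) by linarith+
  have "1 / real (Suc n) < \<eta>"
    using poly_P_root_gt[OF assms(1,4,2)] \<eta>(1) by linarith
  have "poly (P n) \<eta> > 0"
    using poly_P_strict_mono[OF assms(1) _ \<eta>(1)] assms(2,4) by simp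
  then obtain \<delta> w where \<delta>: "1 - \<eta> < real (2 * n - 1) * \<delta>" "\<delta> < 1"
    and w: "1 / \<eta> < w" "w < real n - 1 + real n * (\<eta> * (1 - \<delta>) / (1 - \<eta>))"
    using poly_P_pos_imp_exponents[OF assms(1) \<open>0 < \<eta>\<close> \<eta>(3)] by blast
  define \<alpha> where "\<alpha> = \<eta> * (1 - \<delta>) / (1 - \<eta>)"
  have N: "2 * n \<ge> 2" "2 * n \<ge> 1" using assms(1) by auto
  note sol = uniform_exponent_solutions[OF assms(6) \<eta>(2)]
  obtain T where T: "\<And>t. t \<ge> T \<Longrightarrow> approx_error (2 * n) \<zeta> (best_approx (2 * n) \<zeta> t) \<le> real t powr - \<eta>"
    using best_approx_error_le[OF N(2) \<open>0 < \<eta>\<close> sol] unfolding eventually_sequentially by blast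
  have appr: "\<exists>q\<ge>Q. \<forall>i\<le>n. \<bar>\<zeta> ^ i * real q - real_of_int (approx_point \<zeta> q i)\<bar> \<le> real q powr - \<alpha>" for Q
  proof -
    obtain q where q: "q \<ge> Q" "approx_error (2 * n) \<zeta> q < real q powr - \<alpha>"
      using uniform_imp_ordinary_exponent[where T = T and Q = Q, OF assms(5) N(1) \<open>0 < \<eta>\<close> \<open>\<eta> < 1\<close> \<delta> T]
      unfolding \<alpha>_def by blast
    have "\<bar>\<zeta> ^ i * real q - real_of_int (approx_point \<zeta> q i)\<bar> \<le> real q powr - \<alpha>" if "i \<le> n" for i
      using approx_error_ge[of i "2 * n" \<zeta> q] q(2) that N by linarith
    with q(1) show ?thesis by blast
  qed
  have "0 < 1 / \<eta>" using \<open>0 < \<eta>\<close> by simp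
  hence "w \<ge> 0" using w(1) by linarith
  have "\<exists>f :: int poly. f \<noteq> 0 \<and> degree f \<le> n \<and> \<bar>poly (of_int_poly f) \<zeta>\<bar> * mahler_measure f powr w < \<epsilon>" if "\<epsilon> > 0" for \<epsilon>
  proof (rule khintchine_transference[OF assms(1) that \<open>w \<ge> 0\<close> _ _ appr])
    show "w < real n - 1 + real n * \<alpha>" using w(2) by (simp add: \<alpha>_def)
    show "(1 + \<bar>\<zeta>\<bar>) ^ n + 1 > 0" by (simp add: add_pos_nonneg)
    show "\<bar>real_of_int (approx_point \<zeta> q i)\<bar> \<le> ((1 + \<bar>\<zeta>\<bar>) ^ n + 1) * real q" if "q \<ge> 1" "i \<le> n" for q i
      by (rule approx_point_bound[OF that(2,1)])
  qed
  from contradiction_from_small_polynomials[OF assms(5,1) \<open>1 / real (Suc n) < \<eta>\<close> w(1) sol this]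
  show False .
qed

theorem theorem2p3:
  fixes n :: nat
  assumes "n \<ge> 1"
  shows "(\<exists>!\<theta>. \<theta> \<in> {0<..<1 / real n} \<and> poly (P n) \<theta> = 0) \<and>
         (\<forall>\<theta>. \<theta> \<in> {0<..<1 / real n} \<and> poly (P n) \<theta> = 0 \<longrightarrow>
            (\<forall>\<zeta> :: real. \<not> algebraic \<zeta> \<longrightarrow> lambda_hat (2 * n) \<zeta> \<le> ereal \<theta>))"
proof (intro conjI allI impI)
  show "\<exists>!\<theta>. \<theta> \<in> {0<..<1 / real n} \<and> poly (P n) \<theta> = 0"
    by (rule poly_P_unique_root[OF assms])
next
  fix \<theta> \<zeta> :: real
  assume "\<theta> \<in> {0<..<1 / real n} \<and> poly (P n) \<theta> = 0" "\<not> algebraic \<zeta>"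
  thus "lambda_hat (2 * n) \<zeta> \<le> ereal \<theta>"
    unfolding lambda_hat_def
    by (intro SUP_least) (auto intro: uniform_exponent_le_root[OF assms])
qed

end
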